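(* Let $p$ and $q$ be fixed integers such that $0<p/q\le 1$ and $\gcd(p,q)=1$. Then there is a constant $C_{p,q}>0$ depending only on $p$ and $q$ such that, as $n\to\infty$, for integers $k\in[1,n)$ with $$|k-(p/q)n|\le C_{p,q}\, n^{3/4},$$ the spectral gap of a single card in the overlapping-cycles shuffle with parameters $n$ and $k$ satisfies $$\mathrm{gap}(n,k)=(1+o(1))\,\frac{\pi^2pq}{2n^2}\left(1+\frac{q}{p}\,\frac{|k-(p/q)n|^2}{n}\right)\times\begin{cases}1,&\text{if }p\equiv q\bmod 2,\\4,&\text{if }p\not\equiv q\bmod 2.\end{cases}$$ When $p/q=0$, the spectral gap is instead $$\mathrm{gap}(n,k)=(1+o(1))\,\frac{2\pi^2(k+k^2)}{n^3},$$ provided $1\le k\le (n/2)^{2/3}$. Here $o(1)$ denotes a quantity tending to $0$ as $n\to\infty$ with $p,q$ fixed, uniformly over the allowed values of $k$.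
   Context: Let $n$ and $k$ be integers with $1\le k<n$. The overlapping-cycles shuffle with parameters $n,k$ acts on a deck of $n$ cards: at each step a fair coin is flipped to decide whether to move the card in position $n$ or the card in position $n-k$ to the top of the deck (position $1$). The position of a single card is a Markov chain on $\{1,\dots,n\}$ with the following transitions: from $i\in[1,n-k-1]$ to $i+1$ with probability $1$; from $n-k$ to $1$ or to $n-k+1$, each with probability $1/2$; from $i\in[n-k+1,n-1]$ to $i$ or to $i+1$, each with probability $1/2$; from $n$ to $1$ or to $n$, each with probability $1/2$. $\mathrm{gap}(n,k)$ denotes the spectral gap of this single-card chain, i.e. $1-\max|\lambda|$, where the maximum is over the $n$ eigenvalues of its transition matrix (counted with algebraic multiplicity) after removing one copy of the eigenvalue $1$. *)

theory Defs
  imports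
    "HOL-Analysis.Analysis"
    "HOL-Computational_Algebra.Fundamental_Theorem_Algebra"
    "Jordan_Normal_Form.Char_Poly"
begin

definition single_card_prob :: "nat \<Rightarrow> nat \<Rightarrow> nat \<Rightarrow> nat \<Rightarrow> real" where
  "single_card_prob n k i j =
     (if i < n - k then (if j = i + 1 then 1 else 0)
      else if i = n - k then (if j = 1 \<or> j = n - k + 1 then 1/2 else 0)
      else if i < n then (if j = i \<or> j = i + 1 then 1/2 else 0)
      else (if j = 1 \<or> j = n then 1/2 else 0))"

(* Card positions are 1,...,n, whereas matrix indices start at 0. *)
definition single_card_matrix :: "nat \<Rightarrow> nat \<Rightarrow> real mat" where
  "single_card_matrix n k = mat n n (\<lambda>(i, j). single_card_prob n k (i + 1) (j + 1))"

(* The roots of the characteristic polynomial over the complex numbers, as a multiset, are the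
   eigenvalues with algebraic multiplicity; the multiset difference removes one copy of 1. *)
definition spectral_gap :: "real mat \<Rightarrow> real" where
  "spectral_gap A =
     1 - Max (cmod ` set_mset (proots (char_poly (map_mat complex_of_real A)) - {#1#}))"

definition gap :: "nat \<Rightarrow> nat \<Rightarrow> real" where
  "gap n k = spectral_gap (single_card_matrix n k)"

(* Agreement with the shuffle itself: moving the card in position c to the top sends the card in
   position i to position move_to_top c i, and c is n or n - k according to a fair coin. *)
definition move_to_top :: "nat \<Rightarrow> nat \<Rightarrow> nat" where
  "move_to_top c i = (if i = c then 1 else if i < c then i + 1 else i)"

lemma single_card_prob_eq_coin_flip:
  assumes "1 \<le> k" "k < n" "1 \<le> i" "i \<le> n"
  shows "single_card_prob n k i j =
    1/2 * of_bool (move_to_top n i = j) + 1/2 * of_bool (move_to_top (n - k) i = j)"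
  using assms unfolding single_card_prob_def move_to_top_def by auto

(* The multiset in the definition of the gap is nonempty as soon as there are two positions. *)
lemma size_spectrum_minus_one:
  assumes "A \<in> carrier_mat n n"
  shows "size (proots (char_poly (map_mat complex_of_real A)) - {#1#}) \<ge> n - 1"
proof -
  have "size (proots (char_poly (map_mat complex_of_real A))) = n"
    using assms by (simp add: size_proots_complex degree_monic_char_poly)
  then show ?thesis
    by (metis diff_le_mono diff_size_le_size_Diff size_single order_refl)
qed

end

theory Submission
  imports Defs "HOL-Real_Asymp.Real_Asymp"
begin

text \<open>
The eigenvalues are the roots of \<open>(2\<lambda> - 1)\<^sup>k (2\<lambda>\<^sup>m - 1) = 1\<close> with \<open>m = n - k\<close>, and \<open>1\<close> is a simple root.
If \<open>|\<lambda>|\<close> is close to \<open>1\<close>, neither factor can be much smaller than \<open>1\<close> in modulus, so both are close to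
\<open>1\<close>, and \<open>\<lambda>\<close> and \<open>\<lambda>\<^sup>m\<close> are close to \<open>1\<close>. Writing \<open>z\<close> and \<open>w = m z - 2\<pi>il\<close> for their logarithms and
expanding \<open>Ln (2 exp z - 1) = 2z - z\<^sup>2 + \<dots>\<close>, the equation becomes
\<open>2nz = 2\<pi>iN + k z\<^sup>2 + w\<^sup>2 + \<dots>\<close> with \<open>N = 2l + j\<close> for an integer \<open>j\<close>. To first order
\<open>z = \<pi>iN/n\<close> and \<open>w = \<pi>i(j - kN/n)\<close>, and the real part gives
\<open>1 - |\<lambda>| = (1 + o(1)) (\<pi>\<^sup>2/2n) (k N\<^sup>2/n\<^sup>2 + (j - kN/n)\<^sup>2)\<close>.
Conversely, Brouwer's theorem produces a root near each such lattice point at which the form is small.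
The gap is therefore governed by the minimum of this quadratic form over the nonzero lattice points
\<open>(N, j)\<close> with \<open>N \<equiv> j\<close> modulo \<open>2\<close>. It is attained at \<open>(q, p)\<close> or, if the parities of \<open>p\<close> and \<open>q\<close>
differ, at \<open>(2q, 2p)\<close>; points off the line through \<open>(q, p)\<close> are excluded by Cauchy--Schwarz.
\<close>

section \<open>The characteristic equation\<close>

definition char_equation :: "nat \<Rightarrow> nat \<Rightarrow> complex \<Rightarrow> bool" where
  "char_equation n k x \<longleftrightarrow> (2 * x - 1) ^ k * (2 * x ^ (n - k) - 1) = 1"

text \<open>Solves the right eigenvector equation of the chain in every row except the last; indices start
  at \<open>0\<close> and \<open>m\<close> stands for \<open>n - k\<close>.\<close>

definition eigvec :: "nat \<Rightarrow> complex \<Rightarrow> nat \<Rightarrow> complex" where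
  "eigvec m x i = (if i < m then x ^ i else (2 * x - 1) ^ (i - m) * (2 * x ^ m - 1))"

abbreviation complex_single_card_matrix :: "nat \<Rightarrow> nat \<Rightarrow> complex mat" where
  "complex_single_card_matrix n k \<equiv> map_mat complex_of_real (single_card_matrix n k)"

text \<open>The two coin outcomes average \<open>eigvec\<close> over two target positions, and
  \<open>eigvec\<close> is built so that this average is \<open>x\<close> times the current entry.
  Only the last row, which closes the cycle back to position \<open>1\<close>, leaves a defect: half
  the error in the characteristic equation.\<close>

lemma single_card_matrix_eigvec:
  assumes "1 \<le> k" "k < n" "i < n"
  shows "(\<Sum>j<n. complex_of_real (single_card_prob n k (i + 1) (j + 1)) * eigvec (n - k) x j) =
    x * eigvec (n - k) x i -
      (if i = n - 1 then ((2 * x - 1) ^ k * (2 * x ^ (n - k) - 1) - 1) / 2 else 0)"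
proof -
  let ?m = "n - k"
  let ?a = "move_to_top n (i + 1) - 1" and ?b = "move_to_top ?m (i + 1) - 1"
  have ge: "move_to_top n (i + 1) \<ge> 1" "move_to_top ?m (i + 1) \<ge> 1"
    by (auto simp: move_to_top_def)
  have lt: "?a < n" "?b < n"
    using assms by (auto simp: move_to_top_def)
  have "(\<Sum>j<n. complex_of_real (single_card_prob n k (i + 1) (j + 1)) * eigvec ?m x j) =
    (\<Sum>j<n. (if j = ?a then eigvec ?m x j / 2 else 0) + (if j = ?b then eigvec ?m x j / 2 else 0))"
  proof (rule sum.cong[OF refl])
    fix j assume "j \<in> {..<n}"
    have "move_to_top n (i + 1) = j + 1 \<longleftrightarrow> j = ?a" "move_to_top ?m (i + 1) = j + 1 \<longleftrightarrow> j = ?b"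
      using ge by linarith+
    then show "complex_of_real (single_card_prob n k (i + 1) (j + 1)) * eigvec ?m x j =
      (if j = ?a then eigvec ?m x j / 2 else 0) + (if j = ?b then eigvec ?m x j / 2 else 0)"
      using assms by (subst single_card_prob_eq_coin_flip) (auto simp: of_bool_def)
  qed
  also have "\<dots> = (eigvec ?m x ?a + eigvec ?m x ?b) / 2"
    using lt by (simp add: sum.distrib add_divide_distrib)
  also have "\<dots> = x * eigvec ?m x i -
      (if i = n - 1 then ((2 * x - 1) ^ k * (2 * x ^ ?m - 1) - 1) / 2 else 0)"
  proof -
    have m: "?m \<ge> 1" using assms by simp
    \<comment> \<open>The four kinds of rows: forced moves, position \<open>n - k\<close>, lazy
      positions, and the last position.\<close>
    consider "i < ?m - 1" | "i = ?m - 1" | "?m \<le> i" "i < n - 1" | "i = n - 1" "?m \<le> i"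
      using assms by linarith
    then show ?thesis
    proof cases
      case 1
      then have "?a = i + 1" "?b = i + 1" "i \<noteq> n - 1"
        using assms by (auto simp: move_to_top_def)
      with 1 show ?thesis by (auto simp: eigvec_def)
    next
      case 2
      then have "?a = ?m" "?b = 0" "i \<noteq> n - 1"
        using assms by (auto simp: move_to_top_def)
      moreover have "x ^ ?m = x * x ^ (?m - 1)"
        using m by (cases "n - k") simp_all
      ultimately show ?thesis using 2 m by (auto simp: eigvec_def)
    next
      case 3
      then have "?a = i + 1" "?b = i" "i \<noteq> n - 1"
        using assms by (auto simp: move_to_top_def)
      with 3 show ?thesis by (auto simp: eigvec_def Suc_diff_le field_simps)
    next
      case 4
      then have "?a = 0" "?b = i"
        using assms by (auto simp: move_to_top_def)
      then have e: "eigvec ?m x ?a = 1"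
          "eigvec ?m x ?b = (2 * x - 1) ^ (i - ?m) * (2 * x ^ ?m - 1)"
          "eigvec ?m x i = (2 * x - 1) ^ (i - ?m) * (2 * x ^ ?m - 1)"
        using 4(2) m by (simp_all add: eigvec_def)
      have pow: "(2 * x - 1) ^ k = (2 * x - 1) * (2 * x - 1) ^ (i - ?m)"
      proof -
        have "k = Suc (i - ?m)" using 4 assms by auto
        then show ?thesis by (metis power_Suc)
      qed
      have "(1 + y * v) / 2 = x * (y * v) - ((2 * x - 1) * y * v - 1) / 2" for y v
        by (simp add: field_simps)
      then show ?thesis unfolding e pow if_P[OF 4(1)] .
    qed
  qed
  finally show ?thesis .
qed

text \<open>Multiplying by the adjugate turns the failure of the eigenvector equation in the last row into
  the determinant; the only cofactor involved is triangular and does not depend on \<open>x\<close>.\<close>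

lemma char_poly_single_card_matrix:
  assumes "1 \<le> k" "k < n"
  obtains c :: complex where "c \<noteq> 0"
    "char_poly (complex_single_card_matrix n k) =
      Polynomial.smult c ([:-1, 2:] ^ k * (Polynomial.smult 2 (monom 1 (n - k)) - 1) - 1)"
proof -
  let ?P = "complex_single_card_matrix n k"
  let ?h = "[:-1, 2:] ^ k * (Polynomial.smult 2 (monom 1 (n - k)) - 1) - 1 :: complex poly"
  define A where "A x = - char_matrix ?P x" for x
  define d where "d = (\<Prod>i<n-1. - complex_of_real (single_card_prob n k (i + 1) (i + 2)))"
  \<comment> \<open>The sign comes from the cofactor and the factor \<open>1/2\<close> from the
    defect in the last row.\<close>
  define c where "c = (-1) ^ (n - 1) * d / 2"
  have P: "?P \<in> carrier_mat n n"
    by (simp add: single_card_matrix_def)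
  have h: "poly ?h x = (2 * x - 1) ^ k * (2 * x ^ (n - k) - 1) - 1" for x
  proof -
    have "poly [:-1, 2:] x = 2 * x - 1" by simp
    then show ?thesis by (simp add: poly_monom del: poly_pCons)
  qed
  have A: "A x \<in> carrier_mat n n" for x
    using P by (auto simp: A_def char_matrix_def)
  have A_index: "A x $$ (i, j) =
      (if i = j then x else 0) - complex_of_real (single_card_prob n k (i + 1) (j + 1))"
    if "i < n" "j < n" for x i j
    using that by (auto simp: A_def char_matrix_def single_card_matrix_def)
  have pc: "poly (char_poly ?P) x = det (A x)" for x
    unfolding A_def by (rule char_poly_matrix[OF P])
  have n: "n \<ge> 2" using assms by simp
  \<comment> \<open>Deleting the last row and first column moves the superdiagonal onto the
    diagonal. The position index grows by at most one per step, so everything above it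
    vanishes.\<close>
  have minor: "det (mat_delete (A x) (n - 1) 0) = d" for x
  proof -
    let ?M = "mat_delete (A x) (n - 1) 0"
    have M: "?M \<in> carrier_mat (n - 1) (n - 1)"
      by (rule mat_delete_carrier[OF A])
    have M_index: "?M $$ (i, j) = A x $$ (i, j + 1)" if "i < n - 1" "j < n - 1" for i j
      using that A[of x] by (auto simp: mat_delete_def)
    have "det ?M = prod_list (diag_mat ?M)"
    proof (rule det_lower_triangular[OF _ M])
      fix i j assume "i < j" "j < n - 1"
      then show "?M $$ (i, j) = 0"
        using assms by (subst M_index) (auto simp: A_index single_card_prob_def)
    qed
    also have "\<dots> = (\<Prod>i<n-1. ?M $$ (i, i))"
      using A[of x] by (simp add: prod_list_diag_prod atLeast0LessThan)
    also have "\<dots> = d"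
      unfolding d_def
    proof (rule prod.cong[OF refl])
      fix i assume "i \<in> {..<n - 1}"
      then show "?M $$ (i, i) = - complex_of_real (single_card_prob n k (i + 1) (i + 2))"
        by (subst M_index) (auto simp: A_index)
    qed
    finally show ?thesis .
  qed
  have det_A: "det (A x) = c * poly ?h x" for x
  proof -
    define v where "v = vec n (eigvec (n - k) x)"
    have v: "v \<in> carrier_vec n" by (simp add: v_def)
    have Av: "A x *\<^sub>v v = vec n (\<lambda>i. if i = n - 1 then poly ?h x / 2 else 0)"
    proof (rule eq_vecI)
      fix i assume "i < dim_vec (vec n (\<lambda>i. if i = n - 1 then poly ?h x / 2 else 0))"
      then have i: "i < n" by simp
      have "(A x *\<^sub>v v) $ i = (\<Sum>j<n. A x $$ (i, j) * eigvec (n - k) x j)"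
        using A[of x] i by (auto simp: v_def scalar_prod_def atLeast0LessThan intro!: sum.cong)
      also have "\<dots> = (\<Sum>j<n. (if i = j then x * eigvec (n - k) x j else 0)
          - complex_of_real (single_card_prob n k (i + 1) (j + 1)) * eigvec (n - k) x j)"
        using i by (intro sum.cong) (auto simp: A_index algebra_simps)
      also have "\<dots> = x * eigvec (n - k) x i -
          (\<Sum>j<n. complex_of_real (single_card_prob n k (i + 1) (j + 1)) * eigvec (n - k) x j)"
        using i by (simp add: sum_subtractf)
      also have "\<dots> = (if i = n - 1 then poly ?h x / 2 else 0)"
        unfolding h by (subst single_card_matrix_eigvec[OF assms i]) simp
      finally show "(A x *\<^sub>v v) $ i = vec n (\<lambda>i. if i = n - 1 then poly ?h x / 2 else 0) $ i"
        using i by simp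
    qed (use A[of x] in simp)
    have adj: "adj_mat (A x) \<in> carrier_mat n n" by (rule adj_mat(1)[OF A])
    \<comment> \<open>Entry \<open>0\<close> of this vector identity is read off below: there
      \<open>v\<close> equals \<open>1\<close>, and on the other side only the last entry of
      \<open>A x *\<^sub>v v\<close> survives.\<close>
    have "det (A x) \<cdot>\<^sub>v v = (det (A x) \<cdot>\<^sub>m 1\<^sub>m n) *\<^sub>v v"
      using v by (intro eq_vecI) (auto simp: smult_scalar_prod_distrib[of _ n])
    also have "\<dots> = adj_mat (A x) *\<^sub>v (A x *\<^sub>v v)"
      by (metis adj_mat(3)[OF A] assoc_mult_mat_vec[OF adj A v])
    finally have "(det (A x) \<cdot>\<^sub>v v) $ 0 = (adj_mat (A x) *\<^sub>v (A x *\<^sub>v v)) $ 0" by simp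
    moreover have "(det (A x) \<cdot>\<^sub>v v) $ 0 = det (A x)"
      using n assms by (simp add: v_def eigvec_def)
    moreover have "(adj_mat (A x) *\<^sub>v (A x *\<^sub>v v)) $ 0 =
        (\<Sum>j<n. adj_mat (A x) $$ (0, j) * (if j = n - 1 then poly ?h x / 2 else 0))"
      unfolding Av using n adj by (auto simp: scalar_prod_def atLeast0LessThan intro!: sum.cong)
    moreover have "\<dots> = adj_mat (A x) $$ (0, n - 1) * (poly ?h x / 2)"
    proof -
      have "(\<Sum>j<n. adj_mat (A x) $$ (0, j) * (if j = n - 1 then poly ?h x / 2 else 0)) =
        (\<Sum>j<n. if j = n - 1 then adj_mat (A x) $$ (0, j) * (poly ?h x / 2) else 0)"
        by (intro sum.cong) auto
      then show ?thesis using n by simp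
    qed
    moreover have "adj_mat (A x) $$ (0, n - 1) = (-1) ^ (n - 1) * d"
    proof -
      have "adj_mat (A x) $$ (0, n - 1) = cofactor (A x) (n - 1) 0"
        using n A[of x] by (simp add: adj_mat_def)
      then show ?thesis unfolding cofactor_def minor by simp
    qed
    ultimately show ?thesis by (simp add: c_def)
  qed
  have "c \<noteq> 0"
  proof -
    have "d \<noteq> 0"
      unfolding d_def using assms by (auto simp: single_card_prob_def)
    then show ?thesis by (simp add: c_def)
  qed
  moreover have "char_poly ?P = Polynomial.smult c ?h"
    by (subst poly_eq_poly_eq_iff[symmetric]) (auto simp: pc det_A)
  ultimately show thesis using that by blast
qed

text \<open>The derivative of the characteristic polynomial at \<open>1\<close> is a nonzero
  multiple of \<open>2 * n\<close>, so \<open>1\<close> is a simple root and removing one copy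
  removes it altogether.\<close>

lemma gap_spectrum:
  assumes "1 \<le> k" "k < n"
  shows "set_mset (proots (char_poly (complex_single_card_matrix n k)) - {#1#}) =
    {x. char_equation n k x \<and> x \<noteq> 1}"
proof -
  define h :: "complex poly"
    where "h = [:-1, 2:] ^ k * (Polynomial.smult 2 (monom 1 (n - k)) - 1) - 1"
  obtain c where c: "c \<noteq> 0" and p: "char_poly (complex_single_card_matrix n k) = Polynomial.smult c h"
    unfolding h_def using char_poly_single_card_matrix[OF assms] .
  have "poly (pderiv h) 1 = 2 * of_nat k + 2 * of_nat (n - k)"
    unfolding h_def
    by (simp add: pderiv_mult pderiv_diff pderiv_smult pderiv_monom pderiv_power pderiv_pCons poly_monom)
  also have "\<dots> = 2 * of_nat n"
    using assms by (simp add: of_nat_diff)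
  finally have d: "poly (pderiv h) 1 \<noteq> 0" using assms by simp
  then have h0: "h \<noteq> 0" by (metis pderiv_0 poly_0)
  have "poly h 1 = 0" by (simp add: h_def poly_monom)
  then have "order 1 h = Suc (order 1 (pderiv h))"
    by (rule order_pderiv[OF h0])
  moreover have "order 1 (pderiv h) = 0"
    using d by (rule order_0I)
  ultimately have one: "order 1 h = 1" by simp
  have root: "poly h x = 0 \<longleftrightarrow> char_equation n k x" for x
  proof -
    have "poly [:-1, 2:] x = 2 * x - 1" by simp
    then show ?thesis by (simp add: h_def poly_monom char_equation_def del: poly_pCons)
  qed
  have "x \<in># proots h - {#1#} \<longleftrightarrow> char_equation n k x \<and> x \<noteq> 1" for x
  proof (cases "x = 1")
    case True
    then show ?thesis using one h0 by (simp add: in_diff_count)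
  next
    case False
    then have "x \<in># proots h - {#1#} \<longleftrightarrow> order x h \<noteq> 0"
      using h0 by (simp add: in_diff_count)
    then show ?thesis using False h0 order_root root by metis
  qed
  then show ?thesis unfolding p by (auto simp: proots_smult[OF c])
qed

section \<open>The gap as the distance to the unit circle of the largest root other than 1\<close>

lemma gap_le:
  assumes "1 \<le> k" "k < n" "char_equation n k x" "x \<noteq> 1"
  shows "gap n k \<le> 1 - cmod x"
proof -
  let ?M = "proots (char_poly (complex_single_card_matrix n k)) - {#1#}"
  have "x \<in> set_mset ?M" using assms(3,4) unfolding gap_spectrum[OF assms(1,2)] by simp
  then have "cmod x \<le> Max (cmod ` set_mset ?M)" by (intro Max_ge) auto
  then show ?thesis unfolding gap_def spectral_gap_def by simp
qed

lemma gap_attained: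
  assumes "1 \<le> k" "k < n"
  obtains x where "char_equation n k x" "x \<noteq> 1" "gap n k = 1 - cmod x"
proof -
  let ?M = "proots (char_poly (complex_single_card_matrix n k)) - {#1#}"
  have "size ?M \<ge> n - 1"
    by (rule size_spectrum_minus_one) (simp add: single_card_matrix_def)
  then have "?M \<noteq> {#}" using assms by auto
  then have "Max (cmod ` set_mset ?M) \<in> cmod ` set_mset ?M"
    by (intro Max_in) auto
  then obtain x where "x \<in> set_mset ?M" "Max (cmod ` set_mset ?M) = cmod x" by auto
  then show thesis
    using that[of x] unfolding gap_spectrum[OF assms] gap_def spectral_gap_def by auto
qed

section \<open>Expansion of the logarithms\<close>

text \<open>One function serves both factors: at a logarithm \<open>z\<close> of an eigenvalue
  \<open>x\<close> it is a logarithm of \<open>2 * x - 1\<close>, and at a logarithm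
  \<open>w\<close> of \<open>x ^ m\<close> one of \<open>2 * x ^ m - 1\<close>.\<close>

definition log_fac :: "complex \<Rightarrow> complex" where
  "log_fac z = Ln (2 * exp z - 1)"

text \<open>Mean value bound: the derivative is at most \<open>5 / 4\<close> in modulus on the disc
  of radius \<open>1 / 8\<close>.\<close>

lemma norm_exp_minus_1_small:
  fixes z :: complex
  assumes "cmod z \<le> 1 / 8"
  shows "cmod (exp z - 1) \<le> 5 / 32"
proof -
  have "cmod (exp z - exp 0) \<le> 5 / 4 * cmod (z - 0)"
  proof (rule field_differentiable_bound[where S = "cball 0 (1/8)"])
    fix x :: complex assume "x \<in> cball 0 (1/8)"
    then have "cmod x \<le> 1 / 8" by simp
    then show "cmod (exp x) \<le> 5 / 4" using exp_bound_lemma[of x] by simp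
    show "(exp has_field_derivative exp x) (at x within cball 0 (1/8))"
      by (auto intro!: derivative_eq_intros)
  qed (use assms in auto)
  with assms show ?thesis by simp
qed

text \<open>\<open>D\<close> lies within \<open>5 / 16\<close> of \<open>1\<close>, hence away from
  \<open>0\<close> and from the branch cut of \<open>Ln\<close>.\<close>

lemma log_fac_arg:
  assumes "cmod z \<le> 1 / 8"
  defines "D \<equiv> 2 * exp z - 1"
  shows "1 / 2 \<le> cmod D" "cmod D \<le> 3 / 2" "D \<notin> \<real>\<^sub>\<le>\<^sub>0" "D \<noteq> 0"
proof -
  have d: "cmod (D - 1) \<le> 5 / 16"
  proof -
    have "D - 1 = 2 * (exp z - 1)" by (simp add: D_def)
    then have "cmod (D - 1) = 2 * cmod (exp z - 1)" by (metis norm_mult norm_numeral)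
    then show ?thesis using norm_exp_minus_1_small[OF assms(1)] by simp
  qed
  have "cmod 1 - cmod (D - 1) \<le> cmod D"
    by (metis diff_le_eq norm_diff_triangle_ineq norm_minus_commute norm_triangle_sub)
  then show "1 / 2 \<le> cmod D" using d by simp
  then show "D \<noteq> 0" by auto
  have "cmod D \<le> cmod 1 + cmod (D - 1)" by (rule norm_triangle_sub)
  then show "cmod D \<le> 3 / 2" using d by simp
  have "\<bar>Re (D - 1)\<bar> \<le> 5 / 16" using abs_Re_le_cmod d order_trans by blast
  then have "\<bar>Re D - 1\<bar> \<le> 5 / 16" by simp
  then have "Re D > 0" by linarith
  then show "D \<notin> \<real>\<^sub>\<le>\<^sub>0" by (auto simp: complex_nonpos_Reals_iff)
qed

lemma exp_log_fac:
  assumes "cmod z \<le> 1 / 8"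
  shows "exp (log_fac z) = 2 * exp z - 1"
  using log_fac_arg(4)[OF assms] by (simp add: log_fac_def)

lemma continuous_on_log_fac: "continuous_on (cball 0 (1 / 8)) log_fac"
proof -
  have "continuous_on (cball 0 (1 / 8)) (\<lambda>z. Ln (2 * exp z - 1))"
    using log_fac_arg(3) by (intro continuous_intros) auto
  then show ?thesis by (simp add: log_fac_def[abs_def])
qed

text \<open>Second-order Taylor expansion at \<open>0\<close>, where the first two derivatives are
  \<open>2\<close> and \<open>-2\<close>. The third is at most \<open>50\<close> on the disc, and
  the remainder term divides this by \<open>2!\<close>.\<close>

lemma log_fac_Taylor:
  assumes "cmod z \<le> 1 / 8"
  shows "cmod (log_fac z - (2 * z - z\<^sup>2)) \<le> 25 * cmod z ^ 3"
proof -
  define D where "D z = 2 * exp z - 1" for z :: complex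
  \<comment> \<open>The successive derivatives of \<open>log_fac\<close>, computed from
    \<open>D' = D + 1\<close>.\<close>
  define f where "f i z = (if i = 0 then log_fac z else if i = 1 then 1 + 1 / D z
     else if i = 2 then - (1 / D z + 1 / (D z)\<^sup>2)
     else (1 / (D z)\<^sup>2 + 2 / (D z) ^ 3) * (D z + 1))" for i :: nat and z
  have "cmod (f 0 z - (\<Sum>i\<le>2. f i 0 * (z - 0) ^ i / fact i)) \<le> 50 * cmod (z - 0) ^ Suc 2 / fact 2"
  proof (rule complex_Taylor[where S = "cball 0 (1/8)"])
    fix i :: nat and x :: complex assume x: "x \<in> cball 0 (1/8)" and i: "i \<le> 2"
    have Dx: "D x \<noteq> 0" "D x \<notin> \<real>\<^sub>\<le>\<^sub>0"
      using log_fac_arg[of x] x by (auto simp: D_def)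
    have D': "(D has_field_derivative D x + 1) (at x within cball 0 (1/8))"
      unfolding D_def by (auto intro!: derivative_eq_intros)
    consider "i = 0" | "i = 1" | "i = 2" using i by linarith
    then show "(f i has_field_derivative f (Suc i) x) (at x within cball 0 (1/8))"
    proof cases
      case 1
      have "((\<lambda>z. Ln (D z)) has_field_derivative 1 + 1 / D x) (at x within cball 0 (1/8))"
        using Dx by (auto intro!: derivative_eq_intros D' simp: field_simps)
      then show ?thesis by (simp add: 1 f_def[abs_def] log_fac_def D_def)
    next
      case 2
      have "((\<lambda>z. 1 + 1 / D z) has_field_derivative - (1 / D x + 1 / (D x)\<^sup>2)) (at x within cball 0 (1/8))"
        using Dx by (auto intro!: derivative_eq_intros D' simp: field_simps power2_eq_square)
      then show ?thesis by (simp add: 2 f_def[abs_def])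
    next
      case 3
      have "((\<lambda>z. - (1 / D z + 1 / (D z)\<^sup>2)) has_field_derivative
          (1 / (D x)\<^sup>2 + 2 / (D x) ^ 3) * (D x + 1)) (at x within cball 0 (1/8))"
        using Dx by (auto intro!: derivative_eq_intros D' simp: field_simps power2_eq_square power3_eq_cube)
      then show ?thesis by (simp add: 3 f_def[abs_def])
    qed
  next
    fix x :: complex assume x: "x \<in> cball 0 (1/8)"
    have b: "1 / 2 \<le> cmod (D x)" "cmod (D x) \<le> 3 / 2"
      using log_fac_arg[of x] x by (auto simp: D_def)
    have "cmod (inverse (D x)) \<le> 2"
      using le_imp_inverse_le[OF b(1)] by (simp add: norm_inverse)
    then have p: "cmod (inverse (D x)) ^ 2 \<le> 2 ^ 2" "cmod (inverse (D x)) ^ 3 \<le> 2 ^ 3"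
      by (intro power_mono; simp)+
    have "cmod ((1 / (D x)\<^sup>2 + 2 / (D x) ^ 3) * (D x + 1)) =
        cmod (inverse (D x) ^ 2 + 2 * inverse (D x) ^ 3) * cmod (D x + 1)"
      by (simp add: norm_mult inverse_eq_divide power_one_over)
    \<comment> \<open>With \<open>1 / D\<close> at most \<open>2\<close> in modulus, the first
      factor is at most \<open>4 + 2 * 8\<close> and the second at most
      \<open>3 / 2 + 1\<close>.\<close>
    also have "\<dots> \<le> 20 * (5 / 2)"
    proof (rule mult_mono)
      have "cmod (inverse (D x) ^ 2 + 2 * inverse (D x) ^ 3) \<le>
          cmod (inverse (D x)) ^ 2 + 2 * cmod (inverse (D x)) ^ 3"
        by (rule order_trans[OF norm_triangle_ineq]) (simp add: norm_mult norm_power)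
      then show "cmod (inverse (D x) ^ 2 + 2 * inverse (D x) ^ 3) \<le> 20"
        using p by simp
      show "cmod (D x + 1) \<le> 5 / 2"
        using norm_triangle_ineq[of "D x" 1] b(2) by simp
    qed auto
    finally show "cmod (f (Suc 2) x) \<le> 50" by (simp add: f_def)
  qed (use assms in auto)
  moreover have "(\<Sum>i\<le>2. f i 0 * (z - 0) ^ i / fact i) = 2 * z - z\<^sup>2"
    by (simp add: f_def D_def numeral_2_eq_2 log_fac_def)
  ultimately show ?thesis
    by (simp add: f_def eval_nat_numeral)
qed

section \<open>Roots and lattice points\<close>

text \<open>The two quantities squared are the imaginary parts, divided by \<open>pi\<close>, of the
  first approximations to \<open>z\<close> and \<open>w\<close>.\<close>

definition quad_form :: "nat \<Rightarrow> nat \<Rightarrow> int \<Rightarrow> int \<Rightarrow> real" where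
  "quad_form n k N j = real k * (of_int N / real n)\<^sup>2 + (of_int j - real k * of_int N / real n)\<^sup>2"

text \<open>All nonlinear terms of the logarithmic equation, which in this notation reads exactly
  \<open>2 * n * z = 2 * pi * i * N - log_defect k z w\<close>.\<close>

definition log_defect :: "nat \<Rightarrow> complex \<Rightarrow> complex \<Rightarrow> complex" where
  "log_defect k z w = of_nat k * (log_fac z - 2 * z) + (log_fac w - 2 * w)"

text \<open>The quadratic Taylor terms add up to \<open>-(k * z^2 + w^2)\<close>. The cubic
  remainders lose one factor of modulus at most \<open>\<tau>\<close>; as \<open>k\<close> is at
  least \<open>1\<close>, the bound on \<open>sqrt k * z\<close> also bounds
  \<open>z\<close>.\<close>

lemma log_defect_bounds:
  assumes k: "k \<ge> 1" and z: "sqrt (real k) * cmod z \<le> \<tau>" and w: "cmod w \<le> \<tau>"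
    and \<tau>: "\<tau> \<le> 1 / 50"
  defines "Q \<equiv> real k * (cmod z)\<^sup>2 + (cmod w)\<^sup>2"
  shows "cmod (log_defect k z w + (of_nat k * z\<^sup>2 + w\<^sup>2)) \<le> 25 * \<tau> * Q"
    and "cmod (log_defect k z w) \<le> (1 + 25 * \<tau>) * Q"
proof -
  have "cmod z \<le> sqrt (real k) * cmod z"
    using k by (simp add: mult_le_cancel_right1)
  with z have z': "cmod z \<le> \<tau>" by simp
  have cube: "cmod (log_fac u - 2 * u + u\<^sup>2) \<le> 25 * \<tau> * (cmod u)\<^sup>2" if "cmod u \<le> \<tau>" for u
  proof -
    have "cmod (log_fac u - 2 * u + u\<^sup>2) \<le> 25 * cmod u ^ 3"
      using log_fac_Taylor[of u] that \<tau> by (simp add: algebra_simps)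
    also have "\<dots> = 25 * cmod u * (cmod u)\<^sup>2" by (simp add: power3_eq_cube power2_eq_square)
    also have "\<dots> \<le> 25 * \<tau> * (cmod u)\<^sup>2" using that by (intro mult_right_mono) auto
    finally show ?thesis .
  qed
  have "log_defect k z w + (of_nat k * z\<^sup>2 + w\<^sup>2) =
      of_nat k * (log_fac z - 2 * z + z\<^sup>2) + (log_fac w - 2 * w + w\<^sup>2)"
    by (simp add: log_defect_def algebra_simps)
  also have "cmod \<dots> \<le> real k * cmod (log_fac z - 2 * z + z\<^sup>2) + cmod (log_fac w - 2 * w + w\<^sup>2)"
    by (rule order_trans[OF norm_triangle_ineq]) (simp add: norm_mult)
  also have "\<dots> \<le> real k * (25 * \<tau> * (cmod z)\<^sup>2) + 25 * \<tau> * (cmod w)\<^sup>2"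
    using cube[OF z'] cube[OF w] by (intro add_mono mult_left_mono) auto
  also have "\<dots> = 25 * \<tau> * Q" by (simp add: Q_def algebra_simps)
  finally show 1: "cmod (log_defect k z w + (of_nat k * z\<^sup>2 + w\<^sup>2)) \<le> 25 * \<tau> * Q" .
  have "cmod (of_nat k * z\<^sup>2 + w\<^sup>2) \<le> Q"
    unfolding Q_def by (rule order_trans[OF norm_triangle_ineq]) (simp add: norm_mult norm_power)
  then have "cmod (log_defect k z w) \<le> 25 * \<tau> * Q + Q"
    using 1 norm_diff_ineq[of "log_defect k z w" "of_nat k * z\<^sup>2 + w\<^sup>2"] by linarith
  then show "cmod (log_defect k z w) \<le> (1 + 25 * \<tau>) * Q" by (simp add: algebra_simps)
qed

lemma norm_scaled_Pair:
  "norm (complex_of_real (sqrt (real k)) * z, w) = sqrt (real k * (cmod z)\<^sup>2 + (cmod w)\<^sup>2)"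
  by (simp add: norm_Pair norm_mult power_mult_distrib)

text \<open>When \<open>z\<close> moves by \<open>h\<close>, the logarithm \<open>w\<close> moves by
  \<open>m * h\<close>, so the pair \<open>(sqrt k * z, w)\<close> moves by
  \<open>sqrt (k + m^2)\<close> times the modulus of \<open>h\<close>. This factor is at most
  \<open>n = k + m\<close>, which cancels the \<open>n\<close> in the denominator of the
  correction.\<close>

lemma sqrt_add_square_le:
  assumes "k \<ge> 1"
  shows "sqrt (real k + (real m)\<^sup>2) \<le> real (k + m)"
proof (rule real_le_lsqrt)
  have "real k \<le> real k * real k" using assms by simp
  moreover have "0 \<le> real k * real m" by simp
  moreover have "(real (k + m))\<^sup>2 = real k * real k + 2 * (real k * real m) + (real m)\<^sup>2"
    by (simp add: power2_eq_square algebra_simps)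
  ultimately show "real k + (real m)\<^sup>2 \<le> (real (k + m))\<^sup>2" by linarith
qed auto

text \<open>The pair \<open>(z, w)\<close> stands for logarithms of \<open>\<lambda>\<close> and \<open>\<lambda>\<^sup>m\<close>, and \<open>(z0, w0)\<close> for their
  first approximation. Pairs are compared in the Euclidean norm of \<open>(sqrt k * z, w)\<close>, in which
  the squared norm of \<open>(z0, w0)\<close> is exactly \<open>V\<close>.\<close>

lemma fixed_point_asymptotics:
  fixes k m :: nat and z w z0 w0 :: complex and N j :: int
  assumes k: "k \<ge> 1"
    and z0: "z0 = \<i> * of_real (pi * of_int N / real (k + m))"
    and w0: "w0 = \<i> * of_real (pi * (of_int j - real k * of_int N / real (k + m)))"
    and fz: "z = z0 - log_defect k z w / of_nat (2 * (k + m))"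
    and fw: "w = w0 - of_nat m * log_defect k z w / of_nat (2 * (k + m))"
    and small: "sqrt (real k) * cmod z \<le> \<tau>" "cmod w \<le> \<tau>" and \<tau>: "\<tau> \<le> 1 / 100"
  defines "V \<equiv> pi\<^sup>2 * quad_form (k + m) k N j"
  shows "\<bar>2 * real (k + m) * (- Re z) - V\<bar> \<le> 40 * \<tau> * V"
    and "V = 0 \<Longrightarrow> z = 0"
proof -
  let ?n = "real (k + m)" and ?s = "complex_of_real (sqrt (real k))"
  define H where "H = log_defect k z w"
  define r where "r = norm (?s * z, w)"
  define r0 where "r0 = norm (?s * z0, w0)"
  have n: "?n > 0" using k by simp
  have \<tau>0: "\<tau> \<ge> 0" using small(2) norm_ge_zero order_trans by blast
  have r2: "r\<^sup>2 = real k * (cmod z)\<^sup>2 + (cmod w)\<^sup>2" and r02: "r0\<^sup>2 = real k * (cmod z0)\<^sup>2 + (cmod w0)\<^sup>2"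
    by (simp_all add: r_def r0_def norm_scaled_Pair)
  have r_nonneg: "r \<ge> 0" "r0 \<ge> 0" by (simp_all add: r_def r0_def)
  have r_le: "r \<le> 2 * \<tau>"
  proof -
    have "r \<le> norm (?s * z) + norm w"
      unfolding r_def by (rule norm_Pair_le)
    then show ?thesis using small by (simp add: norm_mult)
  qed
  have norm_i: "(cmod (\<i> * complex_of_real t))\<^sup>2 = t\<^sup>2" for t
    by (simp add: norm_mult)
  have square_i: "(\<i> * complex_of_real t)\<^sup>2 = - complex_of_real (t\<^sup>2)" for t
    by (simp add: power_mult_distrib)
  have V_eq: "V = r0\<^sup>2"
    unfolding r02 z0 w0 norm_i V_def quad_form_def
    by (simp add: power_mult_distrib power_divide distrib_left)
  have H: "cmod (H + (of_nat k * z\<^sup>2 + w\<^sup>2)) \<le> 25 * \<tau> * r\<^sup>2" "cmod H \<le> 2 * r\<^sup>2"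
  proof -
    show "cmod (H + (of_nat k * z\<^sup>2 + w\<^sup>2)) \<le> 25 * \<tau> * r\<^sup>2"
      using log_defect_bounds(1)[OF k small] \<tau> by (simp add: r2 H_def)
    have "cmod H \<le> (1 + 25 * \<tau>) * r\<^sup>2"
      using log_defect_bounds(2)[OF k small] \<tau> by (simp add: r2 H_def)
    also have "\<dots> \<le> 2 * r\<^sup>2" using \<tau> by (intro mult_right_mono) auto
    finally show "cmod H \<le> 2 * r\<^sup>2" .
  qed
  have dz: "z - z0 = - (H / of_nat (2 * (k + m)))" and dw: "w - w0 = - (of_nat m * H / of_nat (2 * (k + m)))"
    using fz fw by (simp_all add: H_def algebra_simps)
  \<comment> \<open>Both corrections are multiples of \<open>H / (2 * n)\<close>, so the pair is
    displaced by at most half the modulus of \<open>H\<close>, which is of second order in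
    \<open>r\<close>.\<close>
  have dist: "norm (?s * (z - z0), w - w0) \<le> r\<^sup>2"
  proof -
    have "real k * (cmod (z - z0))\<^sup>2 + (cmod (w - w0))\<^sup>2 =
        (real k + (real m)\<^sup>2) * (cmod H / (2 * ?n))\<^sup>2"
      unfolding dz dw norm_minus_cancel norm_mult norm_divide norm_of_nat
      by (simp add: power_mult_distrib power_divide algebra_simps add_divide_distrib)
    then have "norm (?s * (z - z0), w - w0) = sqrt (real k + (real m)\<^sup>2) * (cmod H / (2 * ?n))"
      unfolding norm_scaled_Pair using n by (simp add: real_sqrt_mult)
    also have "\<dots> \<le> ?n * (cmod H / (2 * ?n))"
      using sqrt_add_square_le[OF k, of m] n by (intro mult_right_mono) auto
    also have "\<dots> = cmod H / 2"
    proof -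
      have "t * (h / (2 * t)) = h / 2" if "t > 0" for t h :: real using that by simp
      then show ?thesis using n .
    qed
    finally show ?thesis using H(2) by linarith
  qed
  have diff: "(?s * z, w) - (?s * z0, w0) = (?s * (z - z0), w - w0)"
    by (simp add: algebra_simps)
  have tri: "r \<le> r0 + r\<^sup>2" "r0 \<le> r + r\<^sup>2"
    using norm_triangle_ineq2[of "(?s * z, w)" "(?s * z0, w0)"]
      norm_triangle_ineq2[of "(?s * z0, w0)" "(?s * z, w)"] dist
    unfolding norm_minus_commute[of "(?s * z0, w0)"] diff r_def[symmetric] r0_def[symmetric]
    by linarith+
  \<comment> \<open>Since \<open>r\<close> is small, the quadratic error is absorbed, and
    \<open>r\<close> and \<open>r0\<close> become comparable.\<close>
  have r2_le: "r\<^sup>2 \<le> 1 / 50 * r"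
    using r_le \<tau> r_nonneg unfolding power2_eq_square by (intro mult_right_mono) auto
  have r_r0: "r \<le> 50 / 49 * r0" using tri(1) r2_le by linarith
  then have r2_r02: "r\<^sup>2 \<le> (50 / 49)\<^sup>2 * r0\<^sup>2"
    unfolding power_mult_distrib[symmetric] using r_nonneg by (intro power_mono) auto
  show "z = 0" if "V = 0"
  proof -
    have "r = 0" using that V_eq r_r0 r_nonneg by simp
    then have "real k * (cmod z)\<^sup>2 = 0" using r2 by (smt (verit) zero_le_mult_iff zero_le_power2 of_nat_0_le_iff power_zero_numeral)
    then show ?thesis using k by simp
  qed
  have sum_le: "sqrt (real k) * cmod (z + z0) \<le> r + r0" "cmod (w + w0) \<le> r + r0"
  proof -
    have "norm (?s * (z + z0), w + w0) \<le> r + r0"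
      using norm_triangle_ineq[of "(?s * z, w)" "(?s * z0, w0)"]
      by (simp add: r_def r0_def algebra_simps)
    moreover have "sqrt (real k) * cmod (z + z0) \<le> norm (?s * (z + z0), w + w0)"
        "cmod (w + w0) \<le> norm (?s * (z + z0), w + w0)"
      using norm_fst_le[of "?s * (z + z0)" "w + w0"] norm_snd_le[of "w + w0" "?s * (z + z0)"] by (simp_all add: norm_mult)
    ultimately show "sqrt (real k) * cmod (z + z0) \<le> r + r0" "cmod (w + w0) \<le> r + r0"
      by linarith+
  qed
  have diff_le: "sqrt (real k) * cmod (z - z0) \<le> r\<^sup>2" "cmod (w - w0) \<le> r\<^sup>2"
    using norm_fst_le[of "?s * (z - z0)" "w - w0"] norm_snd_le[of "w - w0" "?s * (z - z0)"] dist
    by (simp_all add: norm_mult)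
  have sq0: "of_nat k * z0\<^sup>2 + w0\<^sup>2 = - complex_of_real (r0\<^sup>2)"
    unfolding r02 z0 w0 norm_i square_i by simp
  \<comment> \<open>Differences of squares: the difference factors are at most \<open>r^2\<close>,
    the sum factors at most \<open>r + r0\<close>. The weight \<open>k\<close> is shared between
    them as \<open>sqrt k * sqrt k\<close>.\<close>
  have "cmod (of_nat k * z\<^sup>2 + w\<^sup>2 - (of_nat k * z0\<^sup>2 + w0\<^sup>2)) \<le> 9 * \<tau> * r\<^sup>2"
  proof -
    have s2: "sqrt (real k) * sqrt (real k) = real k" by simp
    have "of_nat k * z\<^sup>2 + w\<^sup>2 - (of_nat k * z0\<^sup>2 + w0\<^sup>2) =
        of_nat k * ((z - z0) * (z + z0)) + (w - w0) * (w + w0)"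
      by (simp add: power2_eq_square algebra_simps)
    also have "cmod \<dots> \<le> real k * (cmod (z - z0) * cmod (z + z0)) + cmod (w - w0) * cmod (w + w0)"
      by (rule order_trans[OF norm_triangle_ineq]) (simp add: norm_mult)
    also have "\<dots> = (sqrt (real k) * cmod (z - z0)) * (sqrt (real k) * cmod (z + z0)) + cmod (w - w0) * cmod (w + w0)"
      by (subst s2[symmetric]) (simp only: ac_simps)
    also have "\<dots> \<le> r\<^sup>2 * (r + r0) + r\<^sup>2 * (r + r0)"
      using diff_le sum_le by (intro add_mono mult_mono) auto
    also have "\<dots> = (2 * (r + r0)) * r\<^sup>2" by (simp add: algebra_simps)
    also have "\<dots> \<le> (9 * \<tau>) * r\<^sup>2"
      using tri(2) r2_le r_le \<tau>0 by (intro mult_right_mono) auto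
    finally show ?thesis .
  qed
  \<comment> \<open>\<open>34 = 25 + 9\<close>: cubic remainder plus change of base point. Passing
    from \<open>r\<close> to \<open>r0\<close> then raises the constant to at most
    \<open>40\<close>.\<close>
  then have "cmod (H - complex_of_real (r0\<^sup>2)) \<le> 34 * \<tau> * r\<^sup>2"
    using H(1) norm_triangle_ineq4[of "H + (of_nat k * z\<^sup>2 + w\<^sup>2)"
        "of_nat k * z\<^sup>2 + w\<^sup>2 - (of_nat k * z0\<^sup>2 + w0\<^sup>2)"]
    unfolding sq0 by (simp add: algebra_simps)
  also have "\<dots> \<le> 34 * \<tau> * ((50 / 49)\<^sup>2 * r0\<^sup>2)"
    using r2_r02 \<tau>0 by (intro mult_left_mono) auto
  also have "\<dots> = (34 * (50 / 49)\<^sup>2) * (\<tau> * r0\<^sup>2)" by simp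
  also have "\<dots> \<le> 40 * (\<tau> * r0\<^sup>2)"
    using \<tau>0 by (intro mult_right_mono) (auto simp: power2_eq_square)
  finally have "\<bar>Re (H - complex_of_real (r0\<^sup>2))\<bar> \<le> 40 * \<tau> * V"
    using abs_Re_le_cmod[of "H - complex_of_real (r0\<^sup>2)"] by (simp add: V_eq)
  \<comment> \<open>\<open>z0\<close> is purely imaginary, so the real part of \<open>z\<close>
    comes from \<open>H\<close> alone.\<close>
  moreover have "Re H = 2 * ?n * (- Re z)"
  proof -
    have "H = c * (z0 - z)" if "z - z0 = - (H / c)" "c \<noteq> 0" for c
      using that by (simp add: field_simps)
    moreover have "of_nat (2 * (k + m)) = complex_of_real (2 * ?n)" by simp
    ultimately have "H = of_real (2 * ?n) * (z0 - z)"
      using dz n by (metis mult_eq_0_iff of_real_eq_0_iff less_irrefl zero_neq_numeral)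
    then have "Re H = 2 * ?n * Re (z0 - z)" by simp
    moreover have "Re z0 = 0" by (simp add: z0)
    ultimately show ?thesis by simp
  qed
  ultimately show "\<bar>2 * ?n * (- Re z) - V\<bar> \<le> 40 * \<tau> * V"
    by (simp add: V_eq)
qed

section \<open>Existence of a root near each lattice point where the form is small\<close>

lemma quad_form_pos:
  assumes "1 \<le> k" "0 < n" "(N, j) \<noteq> (0, 0)"
  shows "quad_form n k N j > 0"
proof (cases "N = 0")
  case True
  then show ?thesis using assms by (simp add: quad_form_def)
next
  case False
  then have "real k * (of_int N / real n)\<^sup>2 > 0" using assms by simp
  then show ?thesis unfolding quad_form_def by (simp add: add_pos_nonneg)
qed

text \<open>Since \<open>m / n = 1 - k / n\<close>, the parity relation turns
  \<open>m * N / n - 2 * l\<close> into \<open>j - k * N / n\<close>; the two base points are thus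
  linked exactly as \<open>z\<close> and \<open>w\<close> are.\<close>

lemma second_base_point:
  fixes N j l :: int
  assumes "N = j + 2 * l" "0 < k + m"
  shows "of_nat m * (\<i> * of_real (pi * of_int N / real (k + m))) - of_real (2 * pi * of_int l) * \<i> =
    \<i> * of_real (pi * (of_int j - real k * of_int N / real (k + m)))"
proof -
  have "(t - real k) * (pi * of_int N / t) - 2 * pi * of_int l = pi * (of_int j - real k * of_int N / t)"
    if "t > 0" for t
    using that by (simp add: assms(1) field_simps)
  from this[of "real (k + m)"]
  have "real m * (pi * of_int N / real (k + m)) - 2 * pi * of_int l =
      pi * (of_int j - real k * of_int N / real (k + m))"
    using assms(2) by simp
  then have "\<i> * of_real (real m * (pi * of_int N / real (k + m)) - 2 * pi * of_int l) =
      \<i> * of_real (pi * (of_int j - real k * of_int N / real (k + m)))"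
    by (rule arg_cong)
  then show ?thesis by (simp only: of_real_diff of_real_mult of_real_of_nat_eq algebra_simps)
qed

text \<open>Brouwer's theorem for \<open>\<Phi>\<close> on the disc of radius \<open>s^2 / n\<close>
  around \<open>z0\<close>. There the defect is at most \<open>2 * s^2\<close>, and division by
  \<open>2 * n\<close> maps the disc into itself. A fixed point exponentiates to a root, whose
  modulus is given by the fixed point asymptotics.\<close>

lemma char_equation_root_exists:
  fixes N j :: int
  assumes k: "1 \<le> k" "k < n" and par: "even (N - j)" and nz: "(N, j) \<noteq> (0, 0)"
    and s: "s \<ge> 0" "s \<le> 1 / 200" "s\<^sup>2 = pi\<^sup>2 * quad_form n k N j"
  obtains x where "char_equation n k x" "x \<noteq> 1"
    "1 - cmod x \<le> (1 + 80 * s) * (pi\<^sup>2 * quad_form n k N j / (2 * real n))"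
proof -
  define m where "m = n - k"
  have n_eq: "n = k + m" and m: "m \<ge> 1" using k by (auto simp: m_def)
  have npos: "real n > 0" using k by simp
  obtain l where l: "N = j + 2 * l" using par by (metis add_diff_cancel_left' diff_add_cancel dvdE add.commute)
  define z0 where "z0 = \<i> * complex_of_real (pi * of_int N / real (k + m))"
  define w0 where "w0 = \<i> * complex_of_real (pi * (of_int j - real k * of_int N / real (k + m)))"
  define W where "W z = of_nat m * z - of_real (2 * pi * of_int l) * \<i>" for z
  define \<Phi> where "\<Phi> z = z0 - log_defect k z (W z) / of_nat (2 * (k + m))" for z
  have W0: "W z0 = w0"
    unfolding W_def z0_def w0_def using second_base_point[OF l, of k m] k by simp
  have W_diff: "W z = w0 + of_nat m * (z - z0)" for z
    unfolding W0[symmetric] W_def by (simp add: algebra_simps)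
  have V_pos: "s\<^sup>2 > 0"
    unfolding s(3) using quad_form_pos[OF k(1) _ nz] npos by simp
  then have s_pos: "s > 0" using s(1) by (cases "s = 0") auto
  have r0: "norm (complex_of_real (sqrt (real k)) * z0, w0) = s"
  proof -
    have norm_i: "(cmod (\<i> * complex_of_real t))\<^sup>2 = t\<^sup>2" for t
      by (simp add: norm_mult)
    have "real k * (cmod z0)\<^sup>2 + (cmod w0)\<^sup>2 = s\<^sup>2"
      unfolding s(3) z0_def w0_def norm_i quad_form_def n_eq
      by (simp add: power_mult_distrib power_divide distrib_left)
    then show ?thesis using s(1) by (simp add: norm_scaled_Pair)
  qed
  \<comment> \<open>On the disc the pair moves by at most \<open>s^2\<close>, which is at most
    \<open>s / 200\<close>, from a base pair of norm \<open>s\<close>.\<close>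
  have near: "sqrt (real k) * cmod z \<le> 2 * s" "cmod (W z) \<le> 2 * s" "cmod (log_defect k z (W z)) \<le> 2 * s\<^sup>2"
    if z: "cmod (z - z0) \<le> s\<^sup>2 / real n" for z
  proof -
    let ?S = "complex_of_real (sqrt (real k))"
    have "norm (?S * (z - z0), W z - w0) = sqrt (real k + (real m)\<^sup>2) * cmod (z - z0)"
    proof -
      have "real k * (cmod (z - z0))\<^sup>2 + (cmod (W z - w0))\<^sup>2 = (real k + (real m)\<^sup>2) * (cmod (z - z0))\<^sup>2"
      proof -
        have "W z - w0 = of_nat m * (z - z0)" by (simp add: W_diff)
        then show ?thesis by (simp add: norm_mult power_mult_distrib distrib_right)
      qed
      then show ?thesis unfolding norm_scaled_Pair by (simp add: real_sqrt_mult)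
    qed
    also have "\<dots> \<le> real n * (s\<^sup>2 / real n)"
      using sqrt_add_square_le[OF k(1), of m] z by (intro mult_mono) (auto simp: n_eq)
    also have "\<dots> = s\<^sup>2" using npos by simp
    finally have d: "norm (?S * (z - z0), W z - w0) \<le> s\<^sup>2" .
    have "(?S * z, W z) = (?S * z0, w0) + (?S * (z - z0), W z - w0)"
      by (simp add: algebra_simps)
    then have r: "norm (?S * z, W z) \<le> s + s\<^sup>2"
      using d r0 norm_triangle_ineq[of "(?S * z0, w0)" "(?S * (z - z0), W z - w0)"] by simp
    have "s\<^sup>2 \<le> s * (1 / 200)" unfolding power2_eq_square using s by (intro mult_left_mono) auto
    with r have r': "norm (?S * z, W z) \<le> 201 / 200 * s" by simp
    then show 1: "sqrt (real k) * cmod z \<le> 2 * s" "cmod (W z) \<le> 2 * s"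
      using norm_fst_le[of "?S * z" "W z"] norm_snd_le[of "W z" "?S * z"] s(1)
      by (simp_all add: norm_mult)
    have "cmod (log_defect k z (W z)) \<le> (1 + 25 * (2 * s)) * (real k * (cmod z)\<^sup>2 + (cmod (W z))\<^sup>2)"
      by (rule log_defect_bounds(2)[OF k(1) 1]) (use s in auto)
    also have "real k * (cmod z)\<^sup>2 + (cmod (W z))\<^sup>2 = (norm (?S * z, W z))\<^sup>2"
      by (simp add: norm_scaled_Pair)
    also have "(1 + 25 * (2 * s)) * \<dots> \<le> (5 / 4) * (201 / 200 * s)\<^sup>2"
      using s r' by (intro mult_mono power_mono) auto
    also have "\<dots> \<le> 2 * s\<^sup>2" by (simp add: power2_eq_square)
    finally show "cmod (log_defect k z (W z)) \<le> 2 * s\<^sup>2" .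
  qed
  have near': "cmod z \<le> 1 / 8" "cmod (W z) \<le> 1 / 8" if "cmod (z - z0) \<le> s\<^sup>2 / real n" for z
  proof -
    have "cmod z \<le> sqrt (real k) * cmod z"
      using k by (simp add: mult_le_cancel_right1)
    then show "cmod z \<le> 1 / 8" "cmod (W z) \<le> 1 / 8" using near(1,2)[OF that] s(2) by linarith+
  qed
  obtain z where z: "z \<in> cball z0 (s\<^sup>2 / real n)" and fz: "\<Phi> z = z"
  proof (rule brouwer_ball)
    show "0 < s\<^sup>2 / real n" using V_pos npos by simp
    have cont_W: "continuous_on (cball z0 (s\<^sup>2 / real n)) W"
      unfolding W_def by (intro continuous_intros)
    have cont: "continuous_on (cball z0 (s\<^sup>2 / real n)) log_fac"
      by (rule continuous_on_subset[OF continuous_on_log_fac])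
        (use near'(1) in \<open>auto simp: dist_norm norm_minus_commute\<close>)
    have cont_comp: "continuous_on (cball z0 (s\<^sup>2 / real n)) (\<lambda>z. log_fac (W z))"
      by (rule continuous_on_compose2[OF continuous_on_log_fac cont_W])
        (use near'(2) in \<open>auto simp: dist_norm norm_minus_commute\<close>)
    have "of_nat (2 * (k + m)) \<noteq> (0 :: complex)" using k unfolding of_nat_eq_0_iff by simp
    then show "continuous_on (cball z0 (s\<^sup>2 / real n)) \<Phi>"
      unfolding \<Phi>_def log_defect_def
      by (intro continuous_on_diff continuous_on_divide continuous_on_add continuous_on_mult
          continuous_on_const continuous_on_id cont cont_W cont_comp ballI)
    show "\<Phi> \<in> cball z0 (s\<^sup>2 / real n) \<rightarrow> cball z0 (s\<^sup>2 / real n)"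
    proof
      fix z assume "z \<in> cball z0 (s\<^sup>2 / real n)"
      then have "cmod (log_defect k z (W z)) \<le> 2 * s\<^sup>2"
        by (intro near(3)) (simp add: dist_norm norm_minus_commute)
      then have "cmod (log_defect k z (W z)) / (2 * real n) \<le> (2 * s\<^sup>2) / (2 * real n)"
        using npos by (intro divide_right_mono) auto
      moreover have "dist z0 (\<Phi> z) = cmod (log_defect k z (W z)) / (2 * real n)"
        unfolding \<Phi>_def dist_norm n_eq[symmetric] by (simp add: norm_divide norm_mult)
      ultimately show "\<Phi> z \<in> cball z0 (s\<^sup>2 / real n)" by simp
    qed
  qed
  from z have z: "cmod (z - z0) \<le> s\<^sup>2 / real n" by (simp add: dist_norm norm_minus_commute)
  have fz: "z = z0 - log_defect k z (W z) / of_nat (2 * (k + m))"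
    using fz by (simp add: \<Phi>_def)
  have fw: "W z = w0 - of_nat m * log_defect k z (W z) / of_nat (2 * (k + m))"
  proof -
    have "z - z0 = - (log_defect k z (W z) / of_nat (2 * (k + m)))" using fz by (simp add: algebra_simps)
    moreover have "w = w' - a * H / c" if "u = - (H / c)" "w = w' + a * u" for w w' a u H c :: complex
      using that by simp
    ultimately show ?thesis using W_diff[of z] by blast
  qed
  have "\<bar>2 * real (k + m) * (- Re z) - pi\<^sup>2 * quad_form (k + m) k N j\<bar> \<le>
      40 * (2 * s) * (pi\<^sup>2 * quad_form (k + m) k N j)"
    by (rule fixed_point_asymptotics(1)[OF k(1) z0_def w0_def fz fw near(1,2)[OF z]]) (use s in auto)
  then have main: "\<bar>2 * real n * (- Re z) - s\<^sup>2\<bar> \<le> 80 * s * s\<^sup>2"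
    unfolding n_eq[symmetric] s(3)[symmetric] by simp
  \<comment> \<open>The imaginary part of \<open>z\<close> is too small for a nonzero period, so
    \<open>z\<close> would be \<open>0\<close>; but the real part is nonzero because
    \<open>80 * s\<close> is at most \<open>2 / 5\<close>.\<close>
  have "exp z \<noteq> 1"
  proof
    assume "exp z = 1"
    then have "exp z = exp 0" by simp
    moreover have "\<bar>Im z\<bar> \<le> 1 / 8" using near'(1)[OF z] abs_Im_le_cmod order_trans by blast
    then have "\<bar>Im z - Im 0\<bar> < 2 * pi" using pi_gt3 by simp
    ultimately have "z = 0" by (rule exp_complex_eqI[rotated])
    with main have "s\<^sup>2 \<le> 80 * s * s\<^sup>2" by simp
    moreover have "80 * s * s\<^sup>2 \<le> 80 * (1 / 200) * s\<^sup>2" using s(1,2) by (intro mult_right_mono) auto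
    ultimately show False using V_pos by linarith
  qed
  moreover have "char_equation n k (exp z)"
  proof -
    have exp_W: "exp (W z) = exp z ^ m"
    proof -
      have "exp (W z) = exp (of_nat m * z)"
        unfolding exp_eq W_def by (rule exI[of _ "- l"]) simp
      then show ?thesis by (simp add: exp_of_nat_mult)
    qed
    \<comment> \<open>The fixed point equation is now solved for the defect: all terms in
      \<open>z\<close> cancel and \<open>2 * pi * i * (N - 2 * l) = 2 * pi * i * j\<close>
      remains.\<close>
    have "of_nat k * log_fac z + log_fac (W z) = log_defect k z (W z) + 2 * of_nat k * z + 2 * W z"
      by (simp add: log_defect_def algebra_simps)
    also have "log_defect k z (W z) = of_nat (2 * (k + m)) * (z0 - z)"
    proof -
      have "of_nat (2 * (k + m)) \<noteq> (0 :: complex)" using k unfolding of_nat_eq_0_iff by simp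
      moreover have "H = c * (z0 - z)" if "z = z0 - H / c" "c \<noteq> 0" for H c
        using that by (simp add: field_simps)
      ultimately show ?thesis using fz by blast
    qed
    also have "of_nat (2 * (k + m)) * (z0 - z) + 2 * of_nat k * z + 2 * W z =
        of_nat (2 * (k + m)) * z0 - 2 * (of_real (2 * pi * of_int l) * \<i>)"
      by (simp add: W_def algebra_simps)
    also have "of_nat (2 * (k + m)) * z0 = of_real (2 * pi * of_int N) * \<i>"
    proof -
      have "real (2 * (k + m)) * (pi * of_int N / real (k + m)) = 2 * pi * of_int N"
        using k by (simp add: field_simps)
      then have "complex_of_real (real (2 * (k + m)) * (pi * of_int N / real (k + m))) * \<i> =
          of_real (2 * pi * of_int N) * \<i>" by simp
      then show ?thesis unfolding z0_def by (simp only: of_real_mult of_real_of_nat_eq ac_simps)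
    qed
    also have "of_real (2 * pi * of_int N) * \<i> - 2 * (of_real (2 * pi * of_int l) * \<i>) =
        of_int (2 * j) * complex_of_real pi * \<i>"
      by (simp add: l algebra_simps)
    finally have "exp (of_nat k * log_fac z + log_fac (W z)) = exp 0"
      unfolding exp_eq by (intro exI[of _ j]) simp
    then have "exp (log_fac z) ^ k * exp (log_fac (W z)) = 1"
      by (simp add: exp_add exp_of_nat_mult)
    then show ?thesis
      using exp_log_fac near'[OF z] by (simp add: char_equation_def exp_W m_def)
  qed
  moreover have "1 - cmod (exp z) \<le> (1 + 80 * s) * (pi\<^sup>2 * quad_form n k N j / (2 * real n))"
  proof -
    have "2 * real n * (- Re z) \<le> (1 + 80 * s) * s\<^sup>2" using main by (simp add: algebra_simps)
    then have "- Re z \<le> (1 + 80 * s) * s\<^sup>2 / (2 * real n)" using npos by (simp add: field_simps)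
    moreover have "1 - cmod (exp z) \<le> - Re z"
      unfolding norm_exp_eq_Re using exp_ge_add_one_self[of "Re z"] by linarith
    ultimately show ?thesis by (simp add: s(3)[symmetric])
  qed
  ultimately show thesis using that by blast
qed

section \<open>Every root close to the unit circle comes from a lattice point\<close>

text \<open>A stability statement: \<open>1\<close> is the only point of modulus at least
  \<open>1\<close> with \<open>2 * \<mu> - 1\<close> in the closed unit disc. The identity opening
  the proof quantifies this as \<open>8 * d\<close> for the squared distance to \<open>1\<close>;
  the logarithm at most doubles the distance, whence \<open>32\<close>.\<close>

lemma Ln_near_one:
  assumes "cmod (2 * \<mu> - 1) \<le> 1 + 4 * d" "cmod \<mu> \<ge> 1 - d" "0 \<le> d" "d \<le> 1 / 64"
  shows "(cmod (Ln \<mu>))\<^sup>2 \<le> 32 * d"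
proof -
  have "2 * (cmod (\<mu> - 1))\<^sup>2 = (cmod (2 * \<mu> - 1))\<^sup>2 + 1 - 2 * (cmod \<mu>)\<^sup>2"
    unfolding cmod_power2 by (simp add: power2_eq_square algebra_simps)
  moreover have "(cmod (2 * \<mu> - 1))\<^sup>2 \<le> (1 + 4 * d)\<^sup>2" using assms by (intro power_mono) auto
  moreover have "(1 - d)\<^sup>2 \<le> (cmod \<mu>)\<^sup>2" using assms by (intro power_mono) auto
  moreover have "d\<^sup>2 \<le> d / 64" unfolding power2_eq_square using mult_left_mono[OF assms(4,3)] by simp
  ultimately have q: "(cmod (\<mu> - 1))\<^sup>2 \<le> 8 * d" using assms(3)
    by (simp add: power2_eq_square algebra_simps)
  also have "\<dots> < (1 / 2)\<^sup>2" using assms(4) by (simp add: power2_eq_square)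
  finally have "cmod (\<mu> - 1) < 1 / 2" by (rule power_less_imp_less_base) simp
  then have "cmod (Ln \<mu>) \<le> 2 * cmod (\<mu> - 1)" using norm_Ln_le[of "\<mu> - 1"] by simp
  then have "(cmod (Ln \<mu>))\<^sup>2 \<le> (2 * cmod (\<mu> - 1))\<^sup>2" by (intro power_mono) auto
  with q show ?thesis by (simp add: power_mult_distrib)
qed

text \<open>A lower bound for the modulus of \<open>x\<close> bounds both factors of the equation
  from below. Their product is \<open>1\<close>, so both are bounded above as well, and
  \<open>x\<close> and \<open>x ^ m\<close> have small logarithms. The branches of these logarithms
  supply the integers \<open>l\<close> and \<open>j\<close>.\<close>

lemma char_equation_root_location:
  fixes \<tau> :: real
  assumes k: "1 \<le> k" "k < n" and x: "char_equation n k x" "x \<noteq> 1"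
    and \<tau>: "0 < \<tau>" "\<tau> \<le> 1 / 100"
    and gap: "1 - cmod x \<le> \<tau>\<^sup>2 / 32 / real n"
  obtains N j :: int where "even (N - j)" "(N, j) \<noteq> (0, 0)"
    "(1 - \<tau>) * (1 - 40 * \<tau>) * (pi\<^sup>2 * quad_form n k N j / (2 * real n)) \<le> 1 - cmod x"
proof -
  define m where "m = n - k"
  \<comment> \<open>Chosen so that the bound \<open>32 * \<eta>\<close> for squared logarithms is
    exactly \<open>\<tau>^2\<close>.\<close>
  define \<eta> where "\<eta> = \<tau>\<^sup>2 / 32"
  define s where "s = \<eta> / real n"
  let ?u = "cmod (2 * x - 1)" and ?v = "cmod (2 * x ^ m - 1)"
  have n_eq: "n = k + m" and m: "m \<ge> 1" using k by (auto simp: m_def)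
  have npos: "real n > 0" using k by simp
  have "\<tau>\<^sup>2 \<le> \<tau> * (1 / 100)" unfolding power2_eq_square using \<tau> by (intro mult_left_mono) auto
  then have \<eta>: "0 < \<eta>" "\<eta> \<le> \<tau>" "\<eta> \<le> 1 / 64" using \<tau> by (auto simp: \<eta>_def)
  have s: "0 < s" "s * real k \<le> \<eta>" "s * real m \<le> \<eta>" "s \<le> \<eta>"
  proof -
    have "s * real n = \<eta>" "0 < s" using npos \<eta> by (auto simp: s_def)
    moreover have "s * real k \<le> s * real n" "s * real m \<le> s * real n" "s * 1 \<le> s * real n"
      using \<open>0 < s\<close> k by (intro mult_left_mono; simp add: n_eq)+
    ultimately show "0 < s" "s * real k \<le> \<eta>" "s * real m \<le> \<eta>" "s \<le> \<eta>" by simp_all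
  qed
  have cx: "cmod x \<ge> 1 - s" using gap by (simp add: s_def \<eta>_def)
  have "cmod (2 * x) - cmod 1 \<le> ?u" by (rule norm_triangle_ineq2)
  then have u: "?u \<ge> 1 - 2 * s" using cx by (simp add: norm_mult)
  have uk: "?u ^ k \<ge> 1 - 2 * \<eta>"
  proof -
    have "1 - 2 * \<eta> \<le> 1 + real k * (- 2 * s)" using s(2) by (simp add: algebra_simps)
    also have "\<dots> \<le> (1 + (- 2 * s)) ^ k" using s \<eta> by (intro Bernoulli_inequality) auto
    also have "\<dots> \<le> ?u ^ k" using u s \<eta> by (intro power_mono) auto
    finally show ?thesis .
  qed
  have xm: "cmod (x ^ m) \<ge> 1 - \<eta>"
  proof -
    have "1 - \<eta> \<le> 1 + real m * (- s)" using s(3) by (simp add: algebra_simps)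
    also have "\<dots> \<le> (1 + (- s)) ^ m" using s \<eta> by (intro Bernoulli_inequality) auto
    also have "\<dots> \<le> cmod x ^ m" using cx s \<eta> by (intro power_mono) auto
    finally show ?thesis by (simp add: norm_power)
  qed
  have "cmod (2 * x ^ m) - cmod 1 \<le> ?v" by (rule norm_triangle_ineq2)
  then have v: "?v \<ge> 1 - 2 * \<eta>" using xm by (simp add: norm_mult)
  have uv: "?u ^ k * ?v = 1"
    using x(1) unfolding char_equation_def m_def
    by (metis norm_mult norm_one norm_power)
  \<comment> \<open>Otherwise the product would exceed
    \<open>(1 + 4 * \<eta>) * (1 - 2 * \<eta>)\<close>, which is larger than \<open>1\<close> for
    small \<open>\<eta>\<close>.\<close>
  have inv_bound: "a \<le> 1 + 4 * \<eta>" if "a * b = 1" "b \<ge> 1 - 2 * \<eta>" "a \<ge> 0" for a b :: real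
  proof (rule ccontr)
    assume "\<not> a \<le> 1 + 4 * \<eta>"
    then have "(1 + 4 * \<eta>) * (1 - 2 * \<eta>) < a * (1 - 2 * \<eta>)"
      using \<eta> by (intro mult_strict_right_mono) auto
    also have "\<dots> \<le> a * b" using that by (intro mult_left_mono) auto
    finally have "2 * \<eta> < 8 * (\<eta> * \<eta>)" using that by (simp add: algebra_simps)
    moreover have "8 * (\<eta> * \<eta>) \<le> 8 * (\<eta> * (1 / 64))" using \<eta> by (intro mult_left_mono) auto
    ultimately show False using \<eta> by simp
  qed
  have vle: "?v \<le> 1 + 4 * \<eta>" using inv_bound[of ?v "?u ^ k"] uv uk by (simp add: mult.commute)
  \<comment> \<open>Bernoulli's inequality extracts the \<open>k\<close>-th root. The gain of
    \<open>1 / k\<close> pays for the weight \<open>sqrt k\<close> on \<open>z\<close>.\<close>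
  have ule: "?u \<le> 1 + 4 * (\<eta> / real k)"
  proof (rule ccontr)
    assume "\<not> ?u \<le> 1 + 4 * (\<eta> / real k)"
    then have "(1 + 4 * (\<eta> / real k)) ^ k < ?u ^ k"
      using k \<eta> by (intro power_strict_mono) auto
    also have "?u ^ k \<le> 1 + 4 * \<eta>" using inv_bound[of "?u ^ k" ?v] uv v by simp
    also have "\<dots> = 1 + real k * (4 * (\<eta> / real k))" using k by simp
    also have "\<dots> \<le> (1 + 4 * (\<eta> / real k)) ^ k"
      using \<eta> by (intro Bernoulli_inequality) (simp add: order_trans[of _ 0])
    finally show False by simp
  qed
  define z w where "z = Ln x" and "w = Ln (x ^ m)"
  have x0: "x \<noteq> 0" using cx s \<eta> by auto
  then have exp_z: "exp z = x" and exp_w: "exp w = x ^ m" by (simp_all add: z_def w_def)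
  have \<eta>k: "\<eta> / real k \<le> \<eta>" "s \<le> \<eta> / real k" "0 \<le> \<eta> / real k"
  proof -
    show "s \<le> \<eta> / real k" unfolding s_def using k \<eta> by (intro divide_left_mono) auto
    show "\<eta> / real k \<le> \<eta>" using k \<eta> by (simp add: divide_le_eq)
  qed (use \<eta> in simp)
  have z_small: "sqrt (real k) * cmod z \<le> \<tau>"
  proof -
    have "\<eta> / real k \<le> 1 / 64" using \<eta>k(1) \<eta>(3) by linarith
    then have "(cmod z)\<^sup>2 \<le> 32 * (\<eta> / real k)"
      unfolding z_def using cx \<eta>k by (intro Ln_near_one[OF ule]) linarith+
    then have "real k * (cmod z)\<^sup>2 \<le> real k * (32 * (\<eta> / real k))" by (intro mult_left_mono) auto
    then have "(sqrt (real k) * cmod z)\<^sup>2 \<le> \<tau>\<^sup>2"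
      using k by (simp add: power_mult_distrib \<eta>_def)
    then show ?thesis by (rule power2_le_imp_le) (use \<tau> in auto)
  qed
  have w_small: "cmod w \<le> \<tau>"
  proof -
    have "(cmod w)\<^sup>2 \<le> 32 * \<eta>"
      unfolding w_def using vle xm \<eta> by (intro Ln_near_one) auto
    then have "(cmod w)\<^sup>2 \<le> \<tau>\<^sup>2" by (simp add: \<eta>_def)
    then show ?thesis by (rule power2_le_imp_le) (use \<tau> in auto)
  qed
  have z8: "cmod z \<le> 1 / 8" and w8: "cmod w \<le> 1 / 8"
  proof -
    have "cmod z \<le> sqrt (real k) * cmod z" using k by (simp add: mult_le_cancel_right1)
    then show "cmod z \<le> 1 / 8" "cmod w \<le> 1 / 8" using z_small w_small \<tau> by linarith+
  qed
  have "exp (of_nat m * z) = exp w" by (simp add: exp_of_nat_mult exp_z exp_w)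
  then obtain l :: int where l: "of_nat m * z = w + of_int (2 * l) * pi * \<i>"
    unfolding exp_eq by auto
  have "exp (of_nat k * log_fac z + log_fac w) = exp 0"
    using x(1) exp_log_fac[OF z8] exp_log_fac[OF w8]
    by (simp add: exp_add exp_of_nat_mult exp_z exp_w char_equation_def m_def)
  then obtain j :: int where j: "of_nat k * log_fac z + log_fac w = of_int (2 * j) * pi * \<i>"
    unfolding exp_eq by auto
  define N where "N = j + 2 * l"
  define z0 where "z0 = \<i> * complex_of_real (pi * of_int N / real (k + m))"
  define w0 where "w0 = \<i> * complex_of_real (pi * (of_int j - real k * of_int N / real (k + m)))"
  have w0: "w0 = of_nat m * z0 - of_real (2 * pi * of_int l) * \<i>"
    unfolding z0_def w0_def using second_base_point[OF N_def, of k m] k by simp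
  have c0: "of_nat (2 * (k + m)) \<noteq> (0 :: complex)" using k unfolding of_nat_eq_0_iff by simp
  have z0': "of_nat (2 * (k + m)) * z0 = of_real (2 * pi * of_int N) * \<i>"
  proof -
    have "real (2 * (k + m)) * (pi * of_int N / real (k + m)) = 2 * pi * of_int N"
      using k by (simp add: field_simps)
    then have "complex_of_real (real (2 * (k + m)) * (pi * of_int N / real (k + m))) * \<i> =
        of_real (2 * pi * of_int N) * \<i>" by simp
    then show ?thesis unfolding z0_def by (simp only: of_real_mult of_real_of_nat_eq ac_simps)
  qed
  have H: "log_defect k z w = of_nat (2 * (k + m)) * (z0 - z)"
  proof -
    have "log_defect k z w = (of_nat k * log_fac z + log_fac w) - 2 * of_nat k * z - 2 * w"
      by (simp add: log_defect_def algebra_simps)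
    also have "2 * w = 2 * (of_nat m * z) - 2 * (of_int (2 * l) * pi * \<i>)" by (simp add: l)
    finally show ?thesis
      unfolding right_diff_distrib[of "of_nat (2 * (k + m))"] z0' j by (simp add: N_def algebra_simps)
  qed
  have fz: "z = z0 - log_defect k z w / of_nat (2 * (k + m))"
    unfolding H using c0 by (simp del: of_nat_mult of_nat_add)
  have fw: "w = w0 - of_nat m * log_defect k z w / of_nat (2 * (k + m))"
  proof -
    have "of_nat m * log_defect k z w / of_nat (2 * (k + m)) = of_nat m * (z0 - z)"
      unfolding H using c0 by (simp del: of_nat_mult of_nat_add)
    moreover have "w0 - of_nat m * (z0 - z) = w" unfolding w0 using l by (simp add: algebra_simps)
    ultimately show ?thesis by (simp only:)
  qed
  note core = fixed_point_asymptotics[OF k(1) z0_def w0_def fz fw z_small w_small \<tau>(2), folded n_eq]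
  \<comment> \<open>The origin corresponds to the excluded root \<open>x = 1\<close>.\<close>
  have nz: "(N, j) \<noteq> (0, 0)"
  proof
    assume "(N, j) = (0, 0)"
    then have "pi\<^sup>2 * quad_form n k N j = 0" by (simp add: quad_form_def)
    then have "z = 0" by (rule core(2))
    then show False using exp_z x(2) by simp
  qed
  have V_pos: "pi\<^sup>2 * quad_form n k N j > 0"
    using quad_form_pos[OF k(1) _ nz] npos by simp
  have lower: "(1 - 40 * \<tau>) * (pi\<^sup>2 * quad_form n k N j / (2 * real n)) \<le> - Re z"
  proof -
    have "(1 - 40 * \<tau>) * (pi\<^sup>2 * quad_form n k N j) \<le> 2 * real n * (- Re z)"
      using core(1) by (simp add: algebra_simps abs_le_iff)
    then show ?thesis using npos by (simp add: field_simps)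
  qed
  have "0 \<le> (1 - 40 * \<tau>) * (pi\<^sup>2 * quad_form n k N j / (2 * real n))"
    using V_pos npos \<tau> by (intro mult_nonneg_nonneg) auto
  with lower have Rez: "- Re z \<ge> 0" by linarith
  \<comment> \<open>From \<open>- Re z\<close> to \<open>1 - cmod x\<close>, which equals
    \<open>cmod x * (exp (- Re z) - 1)\<close>; this costs the factor
    \<open>1 - \<tau>\<close>.\<close>
  have "(1 - \<tau>) * ((1 - 40 * \<tau>) * (pi\<^sup>2 * quad_form n k N j / (2 * real n))) \<le> (1 - \<tau>) * (- Re z)"
    using lower \<tau> by (intro mult_left_mono) auto
  also have "\<dots> \<le> cmod x * (- Re z)"
    using cx s \<eta> Rez by (intro mult_right_mono) auto
  also have "\<dots> \<le> cmod x * (exp (- Re z) - 1)"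
    using exp_ge_add_one_self[of "- Re z"] by (intro mult_left_mono) auto
  also have "\<dots> = 1 - cmod x"
    using exp_z norm_exp_eq_Re[of z] by (simp add: algebra_simps exp_minus)
  finally have "(1 - \<tau>) * (1 - 40 * \<tau>) * (pi\<^sup>2 * quad_form n k N j / (2 * real n)) \<le> 1 - cmod x"
    by (simp only: mult.assoc)
  moreover have "even (N - j)" by (simp add: N_def)
  ultimately show thesis using that nz by blast
qed

section \<open>Minimising the quadratic form\<close>

text \<open>For the upper bound, a root exists near \<open>(N0, j0)\<close>. For the lower bound,
  the root attaining the gap either is so far from the unit circle that the bound is immediate, or
  belongs to a lattice point to which near-minimality applies. The threshold \<open>\<eta>\<close>
  depends on \<open>e\<close> alone, which makes the later estimates uniform in
  \<open>k\<close>.\<close>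

lemma gap_via_quad_form:
  fixes e :: real
  assumes e: "0 < e" "e \<le> 1 / 2"
  obtains \<eta> :: real where "\<eta> > 0"
    "\<And>n k N0 j0. 1 \<le> k \<Longrightarrow> k < n \<Longrightarrow> even (N0 - j0) \<Longrightarrow> (N0, j0) \<noteq> (0, 0) \<Longrightarrow>
      quad_form n k N0 j0 \<le> \<eta> \<Longrightarrow>
      (\<And>N j. even (N - j) \<Longrightarrow> (N, j) \<noteq> (0, 0) \<Longrightarrow> (1 - e) * quad_form n k N0 j0 \<le> quad_form n k N j) \<Longrightarrow>
      (1 - e)\<^sup>2 * (pi\<^sup>2 * quad_form n k N0 j0 / (2 * real n)) \<le> gap n k \<and>
      gap n k \<le> (1 + e) * (pi\<^sup>2 * quad_form n k N0 j0 / (2 * real n))"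
proof -
  \<comment> \<open>\<open>41 * \<tau>\<close> covers the loss
    \<open>(1 - \<tau>) * (1 - 40 * \<tau>)\<close>, and \<open>80 * \<sigma>\<close> the error of
    the existence result. With \<open>\<sigma>\<close> at most \<open>\<tau> / 6\<close>, the value
    \<open>\<sigma>^2 / 2\<close> stays below the threshold \<open>\<tau>^2 / 32\<close> for distant
    roots.\<close>
  define \<tau> where "\<tau> = min (1 / 100) (e / 41)"
  define \<sigma> where "\<sigma> = min (min (1 / 200) (e / 80)) (\<tau> / 6)"
  have \<tau>: "0 < \<tau>" "\<tau> \<le> 1 / 100" "41 * \<tau> \<le> e" using e by (auto simp: \<tau>_def)
  have \<sigma>: "0 < \<sigma>" "\<sigma> \<le> 1 / 200" "80 * \<sigma> \<le> e" "\<sigma> \<le> \<tau> / 6" using e \<tau> by (auto simp: \<sigma>_def)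
  show thesis
  proof (rule that[of "\<sigma>\<^sup>2 / pi\<^sup>2"])
    show "\<sigma>\<^sup>2 / pi\<^sup>2 > 0" using \<sigma> by simp
    fix n k N0 j0
    assume k: "1 \<le> k" "k < n" and par: "even (N0 - j0)" and nz: "(N0, j0) \<noteq> (0, 0)"
      and small: "quad_form n k N0 j0 \<le> \<sigma>\<^sup>2 / pi\<^sup>2"
      and minimal: "\<And>N j. even (N - j) \<Longrightarrow> (N, j) \<noteq> (0, 0) \<Longrightarrow>
        (1 - e) * quad_form n k N0 j0 \<le> quad_form n k N j"
    define T where "T = pi\<^sup>2 * quad_form n k N0 j0 / (2 * real n)"
    define s where "s = sqrt (pi\<^sup>2 * quad_form n k N0 j0)"
    have npos: "real n > 0" using k by simp
    have V0: "quad_form n k N0 j0 > 0" using quad_form_pos[OF k(1) _ nz] npos by simp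
    have V_le: "pi\<^sup>2 * quad_form n k N0 j0 \<le> \<sigma>\<^sup>2" using small by (simp add: field_simps)
    have T_pos: "T > 0" using V0 npos by (simp add: T_def)
    have s: "s \<ge> 0" "s\<^sup>2 = pi\<^sup>2 * quad_form n k N0 j0" using V0 by (simp_all add: s_def)
    have s_le: "s \<le> \<sigma>" unfolding s_def using V_le \<sigma> by (intro real_le_lsqrt) auto
    obtain x where x: "char_equation n k x" "x \<noteq> 1" "1 - cmod x \<le> (1 + 80 * s) * T"
      unfolding T_def using char_equation_root_exists[OF k par nz s(1) _ s(2)] s_le \<sigma> by force
    have "gap n k \<le> (1 + 80 * s) * T" using gap_le[OF k x(1,2)] x(3) by linarith
    also have "\<dots> \<le> (1 + e) * T" using s_le \<sigma> T_pos by (intro mult_right_mono) auto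
    finally have upper: "gap n k \<le> (1 + e) * T" .
    obtain y where y: "char_equation n k y" "y \<noteq> 1" "gap n k = 1 - cmod y"
      using gap_attained[OF k] .
    have lower: "(1 - e)\<^sup>2 * T \<le> gap n k"
    proof (cases "1 - cmod y \<le> \<tau>\<^sup>2 / 32 / real n")
      case False
      have "(1 - e)\<^sup>2 \<le> 1\<^sup>2" using e by (intro power_mono) auto
      then have "(1 - e)\<^sup>2 * T \<le> 1 * T" using T_pos by (intro mult_right_mono) auto
      also have "1 * T \<le> \<sigma>\<^sup>2 / (2 * real n)"
        unfolding T_def using V_le npos by (simp add: divide_right_mono)
      also have "\<dots> \<le> (\<tau> / 6)\<^sup>2 / (2 * real n)"
        using \<sigma> npos by (intro divide_right_mono power_mono) auto
      also have "\<dots> \<le> \<tau>\<^sup>2 / 32 / real n"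
        using npos by (simp add: power_divide field_simps)
      finally show ?thesis using False y(3) by linarith
    next
      case True
      obtain N j :: int where Nj: "even (N - j)" "(N, j) \<noteq> (0, 0)"
        "(1 - \<tau>) * (1 - 40 * \<tau>) * (pi\<^sup>2 * quad_form n k N j / (2 * real n)) \<le> 1 - cmod y"
        using char_equation_root_location[OF k y(1,2) \<tau>(1,2) True] .
      have "(1 - e) * T \<le> pi\<^sup>2 * quad_form n k N j / (2 * real n)"
      proof -
        have "pi\<^sup>2 * ((1 - e) * quad_form n k N0 j0) \<le> pi\<^sup>2 * quad_form n k N j"
          using minimal[OF Nj(1,2)] by (intro mult_left_mono) auto
        then have "pi\<^sup>2 * ((1 - e) * quad_form n k N0 j0) / (2 * real n) \<le> pi\<^sup>2 * quad_form n k N j / (2 * real n)"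
          using npos by (intro divide_right_mono) auto
        then show ?thesis by (simp add: T_def ac_simps)
      qed
      moreover have "1 - e \<le> (1 - \<tau>) * (1 - 40 * \<tau>)"
      proof -
        have "(1 - \<tau>) * (1 - 40 * \<tau>) = 1 - 41 * \<tau> + 40 * \<tau>\<^sup>2"
          by (simp add: power2_eq_square algebra_simps)
        then show ?thesis using \<tau>(3) zero_le_power2[of \<tau>] by linarith
      qed
      ultimately have "(1 - e) * ((1 - e) * T) \<le>
          (1 - \<tau>) * (1 - 40 * \<tau>) * (pi\<^sup>2 * quad_form n k N j / (2 * real n))"
        using e \<tau> T_pos by (intro mult_mono) auto
      then show ?thesis using Nj(3) y(3) by (simp add: power2_eq_square mult.assoc)
    qed
    from upper lower show "(1 - e)\<^sup>2 * (pi\<^sup>2 * quad_form n k N0 j0 / (2 * real n)) \<le> gap n k \<and>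
        gap n k \<le> (1 + e) * (pi\<^sup>2 * quad_form n k N0 j0 / (2 * real n))"
      by (simp add: T_def)
  qed
qed

text \<open>On the line through \<open>(q, p)\<close> the second component of the form is
  proportional to the deviation of \<open>k\<close> from \<open>(p / q) * n\<close>, which is how
  this deviation enters the asymptotics.\<close>

lemma quad_form_multiple:
  fixes a p q :: int
  assumes "q \<noteq> 0" "n > 0"
  shows "quad_form n k (a * q) (a * p) =
    (of_int a)\<^sup>2 * (of_int q)\<^sup>2 / (real n)\<^sup>2 * (real k + (real k - of_int p / of_int q * real n)\<^sup>2)"
proof -
  have "of_int (a * p) - real k * of_int (a * q) / real n =
      - (of_int a * of_int q / real n * (real k - of_int p / of_int q * real n))"
    using assms by (simp add: field_simps)
  then have "(of_int (a * p) - real k * of_int (a * q) / real n)\<^sup>2 =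
      (of_int a * of_int q / real n * (real k - of_int p / of_int q * real n))\<^sup>2"
    by (metis power2_minus)
  then show ?thesis
    by (simp add: quad_form_def power_mult_distrib power_divide distrib_left)
qed

text \<open>Cauchy--Schwarz. Off the line through \<open>(q, p)\<close> the integer \<open>j * q - p * N\<close> is nonzero, so that
  this bounds the form from below.\<close>

lemma quad_form_ge:
  fixes p q N j :: int
  assumes "q \<noteq> 0" "n > 0"
  shows "(of_int (j * q - p * N))\<^sup>2 * real k \<le>
    (of_int q)\<^sup>2 * (real k + (real k - of_int p / of_int q * real n)\<^sup>2) * quad_form n k N j"
proof -
  define x y d where "x = of_int N / real n" and "y = of_int j - real k * of_int N / real n"
    and "d = real k - of_int p / of_int q * real n"
  have "of_int (j * q - p * N) = of_int q * (y + d * x)"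
    using assms by (simp add: x_def y_def d_def field_simps)
  then have "(of_int (j * q - p * N))\<^sup>2 * real k = (of_int q)\<^sup>2 * ((y + d * x)\<^sup>2 * real k)"
    by (simp add: power_mult_distrib)
  also have "(y + d * x)\<^sup>2 * real k \<le> (real k + d\<^sup>2) * (real k * x\<^sup>2 + y\<^sup>2)"
  proof -
    have "(real k + d\<^sup>2) * (real k * x\<^sup>2 + y\<^sup>2) - (y + d * x)\<^sup>2 * real k = (real k * x - d * y)\<^sup>2"
      by (simp add: power2_eq_square algebra_simps)
    then show ?thesis by (metis diff_ge_0_iff_ge zero_le_power2)
  qed
  finally show ?thesis
    by (simp add: mult_left_mono x_def y_def d_def quad_form_def mult.assoc)
qed

text \<open>Turns a sandwich into the form \<open>1 + \<delta>\<close>. The exponents leave room for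
  the errors of the lattice estimate and one further factor for replacing \<open>k\<close> by
  \<open>(p / q) * n\<close>.\<close>

lemma relative_errorI:
  fixes e :: real
  assumes e: "0 < e" "e \<le> 1 / 2" "4 * e \<le> \<epsilon>" and T: "T > 0"
    and "(1 - e) ^ 3 * T \<le> g" "g \<le> (1 + e)\<^sup>2 * T"
  shows "\<exists>\<delta>. \<bar>\<delta>\<bar> < \<epsilon> \<and> g = (1 + \<delta>) * T"
proof (intro exI conjI)
  have "(1 - e) ^ 3 = 1 - 3 * e + e\<^sup>2 * (3 - e)" "(1 + e)\<^sup>2 = 1 + 2 * e + e * e"
    by (simp_all add: power2_eq_square power3_eq_cube algebra_simps)
  moreover have "0 \<le> e\<^sup>2 * (3 - e)" using e by simp
  moreover have "e * e \<le> e * 1" using e by (intro mult_left_mono) auto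
  ultimately have "1 - 3 * e \<le> (1 - e) ^ 3" "(1 + e)\<^sup>2 \<le> 1 + 3 * e" by linarith+
  then have "(1 - 3 * e) * T \<le> g" "g \<le> (1 + 3 * e) * T"
    using assms(5,6) T by (meson mult_right_mono less_imp_le order_trans)+
  then have "1 - 3 * e \<le> g / T" "g / T \<le> 1 + 3 * e" using T by (simp_all add: field_simps)
  then show "\<bar>g / T - 1\<bar> < \<epsilon>" using e by (simp add: abs_less_iff)
  show "g = (1 + (g / T - 1)) * T" using T by simp
qed

section \<open>The regime of small k, where p/q = 0\<close>

text \<open>The near-minimiser is \<open>(2, 0)\<close>: for \<open>j = 0\<close> parity forces
  \<open>N\<close> to be even. For nonzero \<open>j\<close>, Cauchy--Schwarz bounds the form below
  by \<open>1 / (1 + k)\<close>, and the range of \<open>k\<close> means \<open>4 * k^3\<close> is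
  at most \<open>n^2\<close>, which keeps \<open>4 * (k + k^2) / n^2\<close> below that up to a
  factor close to \<open>1\<close>.\<close>

lemma gap_small_k:
  fixes \<epsilon> :: real
  assumes "\<epsilon> > 0"
  shows "\<forall>\<^sub>F n in sequentially. \<forall>k. 1 \<le> k \<and> k < n \<and> real k \<le> (real n / 2) powr (2 / 3) \<longrightarrow>
    (\<exists>\<delta>. \<bar>\<delta>\<bar> < \<epsilon> \<and> gap n k = (1 + \<delta>) * (2 * pi\<^sup>2 * (real k + (real k)\<^sup>2) / (real n) ^ 3))"
proof -
  define e where "e = min (\<epsilon> / 4) (1 / 2)"
  have e: "0 < e" "e \<le> 1 / 2" "4 * e \<le> \<epsilon>" using assms by (auto simp: e_def)
  obtain \<eta> where \<eta>: "\<eta> > 0" and sandwich: "\<And>n k N0 j0. 1 \<le> k \<Longrightarrow> k < n \<Longrightarrow> even (N0 - j0) \<Longrightarrow> (N0, j0) \<noteq> (0, 0) \<Longrightarrow>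
      quad_form n k N0 j0 \<le> \<eta> \<Longrightarrow>
      (\<And>N j. even (N - j) \<Longrightarrow> (N, j) \<noteq> (0, 0) \<Longrightarrow> (1 - e) * quad_form n k N0 j0 \<le> quad_form n k N j) \<Longrightarrow>
      (1 - e)\<^sup>2 * (pi\<^sup>2 * quad_form n k N0 j0 / (2 * real n)) \<le> gap n k \<and>
      gap n k \<le> (1 + e) * (pi\<^sup>2 * quad_form n k N0 j0 / (2 * real n))"
    using gap_via_quad_form[OF e(1,2)] by metis
  \<comment> \<open>Uniform smallness of \<open>k^2 / n^2\<close> puts the form below
    \<open>\<eta>\<close> and lets \<open>e * n^2\<close> absorb the terms of lower order than
    \<open>k^3\<close>.\<close>
  have "(\<lambda>n. ((real n / 2) powr (2 / 3))\<^sup>2 / (real n)\<^sup>2) \<longlonglongrightarrow> 0" by real_asymp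
  then have "\<forall>\<^sub>F n in sequentially. ((real n / 2) powr (2 / 3))\<^sup>2 / (real n)\<^sup>2 < min (\<eta> / 8) (e / 12)"
    using \<eta> e by (intro order_tendstoD) auto
  then show ?thesis
  proof eventually_elim
    case (elim n)
    show ?case
    proof (intro allI impI, elim conjE)
      fix k assume k: "1 \<le> k" "k < n" and k_le: "real k \<le> (real n / 2) powr (2 / 3)"
      have npos: "real n > 0" using k by simp
      have k1: "real k \<ge> 1" using k by simp
      have "(real k)\<^sup>2 / (real n)\<^sup>2 \<le> ((real n / 2) powr (2 / 3))\<^sup>2 / (real n)\<^sup>2"
        using k_le by (intro divide_right_mono power_mono) auto
      then have k2: "(real k)\<^sup>2 / (real n)\<^sup>2 < \<eta> / 8" "(real k)\<^sup>2 / (real n)\<^sup>2 < e / 12"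
        using elim by linarith+
      have kk: "real k \<le> (real k)\<^sup>2" using k1 by (simp add: power2_eq_square)
      have V0: "quad_form n k 2 0 = 4 * (real k + (real k)\<^sup>2) / (real n)\<^sup>2"
        using quad_form_multiple[of 1 n k 2 0] npos by simp
      have k3: "4 * real k ^ 3 \<le> (real n)\<^sup>2"
      proof -
        have "real k ^ 3 \<le> ((real n / 2) powr (2 / 3)) ^ 3" using k_le by (intro power_mono) auto
        also have "\<dots> = (real n / 2)\<^sup>2" using npos by (simp add: powr_power)
        finally show ?thesis by (simp add: power_divide)
      qed
      have "(1 - e)\<^sup>2 * (pi\<^sup>2 * quad_form n k 2 0 / (2 * real n)) \<le> gap n k \<and>
          gap n k \<le> (1 + e) * (pi\<^sup>2 * quad_form n k 2 0 / (2 * real n))"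
      proof (rule sandwich[OF k])
        have "quad_form n k 2 0 \<le> 8 * ((real k)\<^sup>2 / (real n)\<^sup>2)"
          unfolding V0 using kk npos by (simp add: divide_right_mono)
        then show "quad_form n k 2 0 \<le> \<eta>" using k2 by linarith
      next
        fix N j :: int assume par: "even (N - j)" and nz: "(N, j) \<noteq> (0, 0)"
        show "(1 - e) * quad_form n k 2 0 \<le> quad_form n k N j"
        proof (cases "j = 0")
          case True
          obtain a where a: "N = a * 2" using par True by (metis diff_zero dvdE mult.commute)
          with True nz have "a \<noteq> 0" by simp
          then have "1 \<le> a\<^sup>2" by (smt (verit) zero_less_power2)
          then have a1: "1 \<le> (real_of_int a)\<^sup>2" by (metis of_int_1_le_iff of_int_power)
          have "(1 - e) * quad_form n k 2 0 \<le> 1 * quad_form n k 2 0"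
            using e by (intro mult_right_mono) (auto simp: V0)
          also have "\<dots> \<le> (real_of_int a)\<^sup>2 * quad_form n k 2 0"
            using a1 by (intro mult_right_mono) (auto simp: V0)
          also have "\<dots> = quad_form n k N j"
            using True a by (simp add: quad_form_def power_mult_distrib power_divide algebra_simps)
          finally show ?thesis .
        next
          case False
          then have "1 \<le> j\<^sup>2" by (smt (verit) zero_less_power2)
          then have j1: "1 \<le> (real_of_int j)\<^sup>2" by (metis of_int_1_le_iff of_int_power)
          have "(real_of_int j)\<^sup>2 * real k \<le> (real k + (real k)\<^sup>2) * quad_form n k N j"
            using quad_form_ge[of 1 n j 0 N k] npos by simp
          then have "1 * real k \<le> (real k + (real k)\<^sup>2) * quad_form n k N j"
            using j1 mult_right_mono[OF j1, of "real k"] by linarith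
          then have V: "1 \<le> (1 + real k) * quad_form n k N j"
          proof -
            have "(real k + (real k)\<^sup>2) * quad_form n k N j = real k * ((1 + real k) * quad_form n k N j)"
              by (simp add: power2_eq_square algebra_simps)
            with \<open>1 * real k \<le> _\<close> have "real k * 1 \<le> real k * ((1 + real k) * quad_form n k N j)" by linarith
            then show ?thesis using k1 by (simp only: mult_le_cancel_left_pos)
          qed
          have "(1 - e) * (4 * (real k + (real k)\<^sup>2) * (1 + real k)) \<le> (real n)\<^sup>2"
          proof -
            have "4 * (real k + (real k)\<^sup>2) * (1 + real k) = 4 * real k ^ 3 + 8 * (real k)\<^sup>2 + 4 * real k"
              by (simp add: power2_eq_square power3_eq_cube algebra_simps)
            also have "\<dots> \<le> (real n)\<^sup>2 + 12 * (real k)\<^sup>2" using k3 kk by linarith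
            also have "\<dots> \<le> (real n)\<^sup>2 + e * (real n)\<^sup>2"
              using k2(2) npos by (simp add: field_simps)
            finally have "(1 - e) * (4 * (real k + (real k)\<^sup>2) * (1 + real k)) \<le> (1 - e) * ((1 + e) * (real n)\<^sup>2)"
              using e by (intro mult_left_mono) (auto simp: algebra_simps)
            also have "\<dots> = (1 - e\<^sup>2) * (real n)\<^sup>2" by (simp add: power2_eq_square algebra_simps)
            also have "\<dots> \<le> 1 * (real n)\<^sup>2" by (intro mult_right_mono) auto
            finally show ?thesis by simp
          qed
          then have "(1 - e) * quad_form n k 2 0 * (1 + real k) \<le> 1"
            unfolding V0 using npos by (simp add: field_simps)
          also note V
          finally have "(1 + real k) * ((1 - e) * quad_form n k 2 0) \<le> (1 + real k) * quad_form n k N j"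
            by (simp add: mult.commute)
          then show ?thesis using k1 by (simp add: mult_le_cancel_left_pos)
        qed
      qed auto
      moreover have T: "pi\<^sup>2 * quad_form n k 2 0 / (2 * real n) = 2 * pi\<^sup>2 * (real k + (real k)\<^sup>2) / (real n) ^ 3"
        unfolding V0 using npos by (simp add: power2_eq_square power3_eq_cube field_simps)
      ultimately have b: "(1 - e)\<^sup>2 * (2 * pi\<^sup>2 * (real k + (real k)\<^sup>2) / (real n) ^ 3) \<le> gap n k"
        "gap n k \<le> (1 + e) * (2 * pi\<^sup>2 * (real k + (real k)\<^sup>2) / (real n) ^ 3)" by simp_all
      have T_pos: "2 * pi\<^sup>2 * (real k + (real k)\<^sup>2) / (real n) ^ 3 > 0"
        using npos k1 by (simp add: add_pos_nonneg)
      show "\<exists>\<delta>. \<bar>\<delta>\<bar> < \<epsilon> \<and> gap n k = (1 + \<delta>) * (2 * pi\<^sup>2 * (real k + (real k)\<^sup>2) / (real n) ^ 3)"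
      proof (rule relative_errorI[OF e T_pos])
        have "(1 - e) ^ 3 \<le> (1 - e)\<^sup>2" using e by (intro power_decreasing) auto
        then have "(1 - e) ^ 3 * (2 * pi\<^sup>2 * (real k + (real k)\<^sup>2) / (real n) ^ 3) \<le>
            (1 - e)\<^sup>2 * (2 * pi\<^sup>2 * (real k + (real k)\<^sup>2) / (real n) ^ 3)"
          using T_pos by (intro mult_right_mono) auto
        then show "(1 - e) ^ 3 * (2 * pi\<^sup>2 * (real k + (real k)\<^sup>2) / (real n) ^ 3) \<le> gap n k"
          using b(1) by linarith
        have "(1 + e) ^ 1 \<le> (1 + e)\<^sup>2" using e by (intro power_increasing) auto
        then have "(1 + e) * (2 * pi\<^sup>2 * (real k + (real k)\<^sup>2) / (real n) ^ 3) \<le>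
            (1 + e)\<^sup>2 * (2 * pi\<^sup>2 * (real k + (real k)\<^sup>2) / (real n) ^ 3)"
          using T_pos by (intro mult_right_mono) auto
        then show "gap n k \<le> (1 + e)\<^sup>2 * (2 * pi\<^sup>2 * (real k + (real k)\<^sup>2) / (real n) ^ 3)"
          using b(2) by linarith
      qed
    qed
  qed
qed

section \<open>The regime of k near (p/q)n with p/q positive\<close>

text \<open>The source of the factor \<open>4\<close>: if \<open>q - p\<close> is odd, then
  \<open>a * (q - p)\<close> is even only for even \<open>a\<close>.\<close>

lemma even_multiple_square_ge:
  fixes a p q :: int
  assumes "a \<noteq> 0" "even (a * q - a * p)"
  shows "(if p mod 2 = q mod 2 then 1 else 4) \<le> (real_of_int a)\<^sup>2"
proof (cases "p mod 2 = q mod 2")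
  case True
  have "1 \<le> a\<^sup>2" using assms(1) by (smt (verit) zero_less_power2)
  then have "1 \<le> (real_of_int a)\<^sup>2" by (metis of_int_1_le_iff of_int_power)
  then show ?thesis using True by simp
next
  case False
  then have "odd (q - p)" by presburger
  moreover have "even (a * (q - p))" using assms(2) by (simp add: right_diff_distrib)
  ultimately have "even a" by (metis even_mult_iff)
  then obtain b where b: "a = 2 * b" by auto
  then have "1 \<le> b\<^sup>2" using assms(1) by (smt (verit) zero_less_power2)
  then have "1 \<le> (real_of_int b)\<^sup>2" by (metis of_int_1_le_iff of_int_power)
  then show ?thesis using False b by (simp add: power_mult_distrib)
qed

text \<open>The minimiser is \<open>(t * q, t * p)\<close>, with \<open>t\<close> the least positive
  multiplier allowed by parity. Off the line, Cauchy--Schwarz reduces the comparison to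
  \<open>t^2 * q^4 * (k + d^2)^2\<close> being at most \<open>n^2 * k\<close>. As \<open>k\<close>
  has order \<open>n\<close>, this asks for \<open>d^4\<close> to be at most a small multiple of
  \<open>n^3\<close>: hence the window \<open>n powr (3 / 4)\<close>.\<close>

lemma gap_near_rational:
  fixes p q :: int and \<epsilon> :: real
  assumes p: "0 < p" and q: "0 < q" and cop: "gcd p q = 1" and \<epsilon>: "\<epsilon> > 0"
  shows "\<forall>\<^sub>F n in sequentially. \<forall>k. 1 \<le> k \<and> k < n \<and>
      \<bar>real k - (of_int p / of_int q) * real n\<bar> \<le> 1 / (4 * (of_int q)\<^sup>2) * real n powr (3 / 4) \<longrightarrow>
    (\<exists>\<delta>. \<bar>\<delta>\<bar> < \<epsilon> \<and> gap n k = (1 + \<delta>) *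
      (((pi\<^sup>2 * of_int p * of_int q) / (2 * (real n)\<^sup>2)) *
      (1 + (of_int q / of_int p) * (\<bar>real k - (of_int p / of_int q) * real n\<bar>\<^sup>2 / real n)) *
      (if p mod 2 = q mod 2 then 1 else 4)))"
proof -
  define P Q where "P = real_of_int p" and "Q = real_of_int q"
  have P: "P \<ge> 1" and Q: "Q \<ge> 1" using p q by (simp_all add: P_def Q_def)
  define t :: int where "t = (if p mod 2 = q mod 2 then 1 else 2)"
  have t: "t \<noteq> 0" "even (t * q - t * p)" "(real_of_int t)\<^sup>2 = (if p mod 2 = q mod 2 then 1 else 4)"
      "(real_of_int t)\<^sup>2 \<le> 4" "1 \<le> (real_of_int t)\<^sup>2"
  proof -
    show "even (t * q - t * p)"
    proof (cases "p mod 2 = q mod 2")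
      case True
      then have "even (q - p)" by presburger
      then show ?thesis using True by (simp add: t_def)
    qed (simp add: t_def)
  qed (auto simp: t_def)
  define e where "e = min (\<epsilon> / 4) (1 / 2)"
  have e: "0 < e" "e \<le> 1 / 2" "4 * e \<le> \<epsilon>" using \<epsilon> by (auto simp: e_def)
  obtain \<eta> where \<eta>: "\<eta> > 0" and sandwich: "\<And>n k N0 j0. 1 \<le> k \<Longrightarrow> k < n \<Longrightarrow> even (N0 - j0) \<Longrightarrow> (N0, j0) \<noteq> (0, 0) \<Longrightarrow>
      quad_form n k N0 j0 \<le> \<eta> \<Longrightarrow>
      (\<And>N j. even (N - j) \<Longrightarrow> (N, j) \<noteq> (0, 0) \<Longrightarrow> (1 - e) * quad_form n k N0 j0 \<le> quad_form n k N j) \<Longrightarrow>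
      (1 - e)\<^sup>2 * (pi\<^sup>2 * quad_form n k N0 j0 / (2 * real n)) \<le> gap n k \<and>
      gap n k \<le> (1 + e) * (pi\<^sup>2 * quad_form n k N0 j0 / (2 * real n))"
    using gap_via_quad_form[OF e(1,2)] by metis
  have "(\<lambda>n. (real n + (real n powr (3 / 4))\<^sup>2) / (real n)\<^sup>2) \<longlonglongrightarrow> 0" by real_asymp
  then have E1: "\<forall>\<^sub>F n in sequentially. (real n + (real n powr (3 / 4))\<^sup>2) / (real n)\<^sup>2 < \<eta> / (4 * Q\<^sup>2)"
    using \<eta> Q by (intro order_tendstoD) auto
  have "(\<lambda>n. real n powr (3 / 4) / real n) \<longlonglongrightarrow> 0" by real_asymp
  then have E2: "\<forall>\<^sub>F n in sequentially. real n powr (3 / 4) / real n < e / Q"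
    using e Q by (intro order_tendstoD) auto
  have E3: "\<forall>\<^sub>F n in sequentially. 16 * Q ^ 4 \<le> real n"
    by real_asymp
  from E1 E2 E3 show ?thesis
  proof eventually_elim
    case (elim n)
    show ?case
    proof (intro allI impI, elim conjE)
      fix k assume k: "1 \<le> k" "k < n"
        and close: "\<bar>real k - (of_int p / of_int q) * real n\<bar> \<le> 1 / (4 * (of_int q)\<^sup>2) * real n powr (3 / 4)"
      define d where "d = real k - P / Q * real n"
      define Y where "Y = real n powr (3 / 4)"
      define V0 where "V0 = quad_form n k (t * q) (t * p)"
      define T where "T = pi\<^sup>2 * V0 / (2 * real n)"
      define T' where "T' = ((pi\<^sup>2 * P * Q) / (2 * (real n)\<^sup>2)) * (1 + (Q / P) * (\<bar>d\<bar>\<^sup>2 / real n)) * (real_of_int t)\<^sup>2"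
      have npos: "real n > 0" using k by simp
      have k1: "real k \<ge> 1" using k by simp
      have Y: "Y \<ge> 0" "Y ^ 4 = real n ^ 3"
        using npos by (simp_all add: Y_def powr_power)
      have d: "\<bar>d\<bar> \<le> 1 / (4 * Q\<^sup>2) * Y"
        using close by (simp add: d_def P_def Q_def Y_def)
      also have "\<dots> \<le> 1 * Y"
      proof (rule mult_right_mono)
        have "1 \<le> Q\<^sup>2" using Q by (rule one_le_power)
        then show "1 / (4 * Q\<^sup>2) \<le> 1" by (simp add: divide_le_eq)
      qed (rule Y)
      finally have dY: "\<bar>d\<bar> \<le> Y" by simp
      have dn: "\<bar>d\<bar> \<le> e / Q * real n"
      proof -
        have "Y \<le> e / Q * real n" using elim(2) npos by (simp add: Y_def divide_less_eq)
        with dY show ?thesis by linarith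
      qed
      have d2: "d\<^sup>2 \<le> Y\<^sup>2" using dY by (metis abs_ge_zero power2_abs power_mono)
      have d4: "d ^ 4 \<le> real n ^ 3 / (256 * Q ^ 8)"
      proof -
        have "\<bar>d\<bar> ^ 4 \<le> (1 / (4 * Q\<^sup>2) * Y) ^ 4" using d by (intro power_mono) auto
        also have "\<dots> = real n ^ 3 / (256 * Q ^ 8)"
          by (simp add: power_mult_distrib power_divide Y(2) flip: power_mult)
        finally show ?thesis by simp
      qed
      \<comment> \<open>\<open>k\<close> is within \<open>e * n / Q\<close> of
        \<open>P * n / Q\<close>, and \<open>P - e\<close> is at least \<open>1 / 2\<close>.\<close>
      have k_lower: "real n / (2 * Q) \<le> real k"
      proof -
        have "P / Q * real n - e / Q * real n \<le> real k" using dn unfolding d_def by linarith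
        moreover have "1 / 2 / Q * real n \<le> (P - e) / Q * real n"
          using P e Q npos by (intro mult_right_mono divide_right_mono) auto
        ultimately show ?thesis by (simp add: diff_divide_distrib left_diff_distrib)
      qed
      have V0_eq: "V0 = (real_of_int t)\<^sup>2 * Q\<^sup>2 / (real n)\<^sup>2 * (real k + d\<^sup>2)"
        unfolding V0_def using quad_form_multiple[of q n k t p] q npos by (simp add: d_def P_def Q_def)
      have V0_pos: "V0 > 0"
        unfolding V0_eq using t(5) Q npos k1 by (intro mult_pos_pos divide_pos_pos) (auto simp: add_pos_nonneg)
      have sand: "(1 - e)\<^sup>2 * T \<le> gap n k \<and> gap n k \<le> (1 + e) * T"
        unfolding T_def V0_def
      proof (rule sandwich[OF k t(2)])
        show "(t * q, t * p) \<noteq> (0, 0)" using t(1) q by simp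
        have "V0 = ((real_of_int t)\<^sup>2 * Q\<^sup>2) * ((real k + d\<^sup>2) / (real n)\<^sup>2)" by (simp add: V0_eq)
        also have "\<dots> \<le> (4 * Q\<^sup>2) * ((real n + Y\<^sup>2) / (real n)\<^sup>2)"
          using t(4) d2 k by (intro mult_mono divide_right_mono add_mono) auto
        also have "\<dots> \<le> (4 * Q\<^sup>2) * (\<eta> / (4 * Q\<^sup>2))"
          using elim(1) by (intro mult_left_mono) (auto simp: Y_def)
        also have "\<dots> = \<eta>" using Q by simp
        finally show "quad_form n k (t * q) (t * p) \<le> \<eta>" by (simp add: V0_def)
      next
        fix N j :: int assume par: "even (N - j)" and nz: "(N, j) \<noteq> (0, 0)"
        have "V0 \<le> quad_form n k N j"
        proof (cases "j * q = p * N")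
          case True
          \<comment> \<open>Coprimality makes the lattice points on the line exactly the multiples
            of \<open>(q, p)\<close>.\<close>
          then have "q dvd p * N" by (metis dvd_triv_right)
          moreover have "coprime q p" using cop by (simp add: coprime_iff_gcd_eq_1 gcd.commute)
          ultimately have "q dvd N" by (simp add: coprime_dvd_mult_right_iff)
          then obtain a where a: "N = a * q" by (metis dvdE mult.commute)
          with True have j: "j = a * p" using q by simp
          have a0: "a \<noteq> 0" using nz a j by auto
          have "(real_of_int t)\<^sup>2 \<le> (real_of_int a)\<^sup>2"
            unfolding t(3) using even_multiple_square_ge[OF a0] par a j by simp
          then have "(real_of_int t)\<^sup>2 * (Q\<^sup>2 / (real n)\<^sup>2 * (real k + d\<^sup>2)) \<le>
              (real_of_int a)\<^sup>2 * (Q\<^sup>2 / (real n)\<^sup>2 * (real k + d\<^sup>2))"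
            by (intro mult_right_mono) auto
          also have "\<dots> = quad_form n k N j"
            unfolding a j using quad_form_multiple[of q n k a p] q npos by (simp add: d_def P_def Q_def)
          finally show ?thesis by (simp add: V0_eq)
        next
          case False
          let ?r = "Q\<^sup>2 * (real k + d\<^sup>2)"
          have r: "?r > 0" using Q k1 by (intro mult_pos_pos) (auto simp: add_pos_nonneg)
          have "1 \<le> (j * q - p * N)\<^sup>2" using False by (smt (verit) zero_less_power2)
          then have "1 \<le> (real_of_int (j * q - p * N))\<^sup>2" by (metis of_int_1_le_iff of_int_power)
          then have "1 * real k \<le> (real_of_int (j * q - p * N))\<^sup>2 * real k"
            by (intro mult_right_mono) auto
          also have "\<dots> \<le> ?r * quad_form n k N j"
            using quad_form_ge[of q n j p N k] q npos by (simp add: d_def P_def Q_def)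
          finally have V: "real k \<le> ?r * quad_form n k N j" by simp
          have "?r * V0 \<le> real k"
          proof -
            have "(real n)\<^sup>2 * (?r * V0) = (real_of_int t)\<^sup>2 * (Q ^ 4 * (real k + d\<^sup>2)\<^sup>2)"
              unfolding V0_eq using npos by (simp add: power2_eq_square power4_eq_xxxx)
            also have "\<dots> \<le> 4 * (Q ^ 4 * (2 * (real k)\<^sup>2 + 2 * d ^ 4))"
            proof (intro mult_mono)
              have "0 \<le> (real k - d\<^sup>2)\<^sup>2" by simp
              then show "(real k + d\<^sup>2)\<^sup>2 \<le> 2 * (real k)\<^sup>2 + 2 * d ^ 4"
                by (simp add: power2_eq_square power4_eq_xxxx algebra_simps)
            qed (use t(4) Q in auto)
            also have "\<dots> = (16 * Q ^ 4) * real k * real k / 2 + 8 * Q ^ 4 * d ^ 4"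
              by (simp add: power2_eq_square algebra_simps)
            \<comment> \<open>Half of the budget \<open>n^2 * k\<close> for each term: the one in
              \<open>k^2\<close> uses that \<open>n\<close> is large, the one in \<open>d^4\<close>
              the window and the lower bound on \<open>k\<close>.\<close>
            also have "\<dots> \<le> real n * real n * real k / 2 + real n * real n * real k / 2"
            proof (intro add_mono)
              show "16 * Q ^ 4 * real k * real k / 2 \<le> real n * real n * real k / 2"
                using elim(3) k by (intro divide_right_mono mult_right_mono mult_mono) auto
              have "8 * Q ^ 4 * d ^ 4 \<le> 8 * Q ^ 4 * (real n ^ 3 / (256 * Q ^ 8))"
                using d4 by (intro mult_left_mono) auto
              also have "\<dots> = real n ^ 3 / (32 * Q ^ 4)"
              proof -
                have "Q ^ 8 = Q ^ 4 * Q ^ 4" by (simp flip: power_add)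
                moreover have "8 * a * (b / (256 * (a * a))) = b / (32 * a)" if "a > 0" for a b :: real
                  using that by (simp add: field_simps)
                moreover have "Q ^ 4 > 0" using Q by simp
                ultimately show ?thesis by metis
              qed
              also have "\<dots> \<le> real n ^ 3 / (4 * Q)"
              proof (rule divide_left_mono)
                have "Q ^ 1 \<le> Q ^ 4" using Q by (intro power_increasing) auto
                then show "4 * Q \<le> 32 * Q ^ 4" using Q by simp
              qed (use Q in auto)
              also have "\<dots> = (real n * real n) * (real n / (2 * Q)) / 2"
                by (simp add: power3_eq_cube)
              also have "\<dots> \<le> real n * real n * real k / 2"
                using k_lower by (intro divide_right_mono mult_left_mono) auto
              finally show "8 * Q ^ 4 * d ^ 4 \<le> real n * real n * real k / 2" .
            qed
            also have "\<dots> = (real n)\<^sup>2 * real k" by (simp add: power2_eq_square)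
            finally show ?thesis using npos by (simp add: mult_le_cancel_left_pos)
          qed
          with V have "?r * V0 \<le> ?r * quad_form n k N j" by linarith
          then show ?thesis using r by (simp only: mult_le_cancel_left_pos)
        qed
        moreover have "(1 - e) * V0 \<le> 1 * V0" using e V0_pos by (intro mult_right_mono) auto
        ultimately show "(1 - e) * quad_form n k (t * q) (t * p) \<le> quad_form n k N j"
          by (simp add: V0_def)
      qed
      have T'_eq: "T' = pi\<^sup>2 * (real_of_int t)\<^sup>2 * Q\<^sup>2 / (2 * real n ^ 3) * (P / Q * real n + d\<^sup>2)"
        unfolding T'_def using npos P Q by (simp add: power2_eq_square power3_eq_cube field_simps)
      have T_eq: "T = pi\<^sup>2 * (real_of_int t)\<^sup>2 * Q\<^sup>2 / (2 * real n ^ 3) * (real k + d\<^sup>2)"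
        unfolding T_def V0_eq using npos by (simp add: power2_eq_square power3_eq_cube)
      have c_pos: "pi\<^sup>2 * (real_of_int t)\<^sup>2 * Q\<^sup>2 / (2 * real n ^ 3) > 0"
        using t(5) Q npos by (intro divide_pos_pos mult_pos_pos) auto
      have m_pos: "P / Q * real n + d\<^sup>2 > 0"
        using P Q npos by (intro add_pos_nonneg) auto
      have T'_pos: "T' > 0" unfolding T'_eq using c_pos m_pos by (rule mult_pos_pos)
      \<comment> \<open>As \<open>d\<close> is small against \<open>n\<close>, replacing
        \<open>k\<close> by \<open>(P / Q) * n\<close> in the bracket changes it by a relative error
        of at most \<open>e\<close>.\<close>
      have d_le: "\<bar>d\<bar> \<le> e * (P / Q * real n + d\<^sup>2)"
      proof -
        have "e / Q * real n \<le> e * (P / Q * real n)"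
          using P Q e npos by (simp add: divide_right_mono)
        also have "\<dots> \<le> e * (P / Q * real n + d\<^sup>2)" using e by (intro mult_left_mono) auto
        finally show ?thesis using dn by linarith
      qed
      have kd: "real k + d\<^sup>2 = (P / Q * real n + d\<^sup>2) + d" by (simp add: d_def)
      have T_le: "T \<le> (1 + e) * T'" "(1 - e) * T' \<le> T"
      proof -
        have "real k + d\<^sup>2 \<le> (1 + e) * (P / Q * real n + d\<^sup>2)"
          "(1 - e) * (P / Q * real n + d\<^sup>2) \<le> real k + d\<^sup>2"
          using d_le unfolding kd by (simp_all add: distrib_right left_diff_distrib abs_le_iff)
        from mult_left_mono[OF this(1) less_imp_le[OF c_pos]] mult_left_mono[OF this(2) less_imp_le[OF c_pos]]
        show "T \<le> (1 + e) * T'" "(1 - e) * T' \<le> T"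
          unfolding T_eq T'_eq by (simp_all only: ac_simps)
      qed
      have "\<exists>\<delta>. \<bar>\<delta>\<bar> < \<epsilon> \<and> gap n k = (1 + \<delta>) * T'"
      proof (rule relative_errorI[OF e T'_pos])
        have "(1 - e) ^ 3 * T' = (1 - e)\<^sup>2 * ((1 - e) * T')"
          by (simp add: power2_eq_square power3_eq_cube)
        also have "\<dots> \<le> (1 - e)\<^sup>2 * T" using T_le(2) by (intro mult_left_mono) auto
        finally show "(1 - e) ^ 3 * T' \<le> gap n k" using sand by linarith
        have "(1 + e) * T \<le> (1 + e) * ((1 + e) * T')" using T_le(1) e by (intro mult_left_mono) auto
        also have "\<dots> = (1 + e)\<^sup>2 * T'" by (simp add: power2_eq_square)
        finally show "gap n k \<le> (1 + e)\<^sup>2 * T'" using sand by linarith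
      qed
      then show "\<exists>\<delta>. \<bar>\<delta>\<bar> < \<epsilon> \<and> gap n k = (1 + \<delta>) *
        (((pi\<^sup>2 * of_int p * of_int q) / (2 * (real n)\<^sup>2)) *
        (1 + (of_int q / of_int p) * (\<bar>real k - (of_int p / of_int q) * real n\<bar>\<^sup>2 / real n)) *
        (if p mod 2 = q mod 2 then 1 else 4))"
        unfolding T'_def t(3) by (simp only: P_def Q_def d_def)
    qed
  qed
qed

section \<open>The two regimes combined\<close>

theorem theorem3:
  shows "(\<forall>p q :: int.
            0 < real_of_int p / real_of_int q \<and> real_of_int p / real_of_int q \<le> 1 \<and> gcd p q = 1 \<longrightarrow>
            (\<exists>C :: real. C > 0 \<and>
              (\<forall>\<epsilon> :: real. \<epsilon> > 0 \<longrightarrow>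
                (\<forall>\<^sub>F n :: nat in sequentially. \<forall>k :: nat.
                   1 \<le> k \<and> k < n \<and>
                   \<bar>real k - (real_of_int p / real_of_int q) * real n\<bar> \<le> C * real n powr (3/4) \<longrightarrow>
                   (\<exists>\<delta> :: real. \<bar>\<delta>\<bar> < \<epsilon> \<and>
                      gap n k = (1 + \<delta>) *
                        ((pi\<^sup>2 * real_of_int p * real_of_int q) / (2 * (real n)\<^sup>2)) *
                        (1 + (real_of_int q / real_of_int p) *
                             (\<bar>real k - (real_of_int p / real_of_int q) * real n\<bar>\<^sup>2 / real n)) *
                        (if p mod 2 = q mod 2 then 1 else 4))))))
       \<and> (\<forall>\<epsilon> :: real. \<epsilon> > 0 \<longrightarrow>
            (\<forall>\<^sub>F n :: nat in sequentially. \<forall>k :: nat.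
               1 \<le> k \<and> k < n \<and> real k \<le> (real n / 2) powr (2/3) \<longrightarrow>
               (\<exists>\<delta> :: real. \<bar>\<delta>\<bar> < \<epsilon> \<and>
                  gap n k = (1 + \<delta>) * (2 * pi\<^sup>2 * (real k + (real k)\<^sup>2) / (real n) ^ 3))))"
proof (intro conjI allI impI)
  fix p q :: int
  assume "0 < real_of_int p / real_of_int q \<and> real_of_int p / real_of_int q \<le> 1 \<and> gcd p q = 1"
  then have pos: "0 < real_of_int p / real_of_int q" and cop: "gcd p q = 1" by auto
  show "\<exists>C :: real. C > 0 \<and>
    (\<forall>\<epsilon> :: real. \<epsilon> > 0 \<longrightarrow>
      (\<forall>\<^sub>F n :: nat in sequentially. \<forall>k :: nat.
         1 \<le> k \<and> k < n \<and>
         \<bar>real k - (real_of_int p / real_of_int q) * real n\<bar> \<le> C * real n powr (3/4) \<longrightarrow>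
         (\<exists>\<delta> :: real. \<bar>\<delta>\<bar> < \<epsilon> \<and>
            gap n k = (1 + \<delta>) *
              ((pi\<^sup>2 * real_of_int p * real_of_int q) / (2 * (real n)\<^sup>2)) *
              (1 + (real_of_int q / real_of_int p) *
                   (\<bar>real k - (real_of_int p / real_of_int q) * real n\<bar>\<^sup>2 / real n)) *
              (if p mod 2 = q mod 2 then 1 else 4))))"
  proof (intro exI[of _ "1 / (4 * (real_of_int q)\<^sup>2)"] conjI allI impI)
    show "1 / (4 * (real_of_int q)\<^sup>2) > 0" using pos by (cases "q = 0") auto
    fix \<epsilon> :: real assume \<epsilon>: "\<epsilon> > 0"
    \<comment> \<open>A positive quotient also allows both integers to be negative. The formula, the
      gcd and the parity condition are unchanged under a simultaneous change of sign.\<close>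
    consider "0 < p" "0 < q" | "0 < - p" "0 < - q"
      using pos by (auto simp: zero_less_divide_iff)
    then show "\<forall>\<^sub>F n :: nat in sequentially. \<forall>k :: nat.
         1 \<le> k \<and> k < n \<and>
         \<bar>real k - (real_of_int p / real_of_int q) * real n\<bar> \<le> 1 / (4 * (real_of_int q)\<^sup>2) * real n powr (3/4) \<longrightarrow>
         (\<exists>\<delta> :: real. \<bar>\<delta>\<bar> < \<epsilon> \<and>
            gap n k = (1 + \<delta>) *
              ((pi\<^sup>2 * real_of_int p * real_of_int q) / (2 * (real n)\<^sup>2)) *
              (1 + (real_of_int q / real_of_int p) *
                   (\<bar>real k - (real_of_int p / real_of_int q) * real n\<bar>\<^sup>2 / real n)) *
              (if p mod 2 = q mod 2 then 1 else 4))"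
    proof cases
      case 1
      show ?thesis
        using gap_near_rational[OF 1 cop \<epsilon>] unfolding mult.assoc .
    next
      case 2
      have cop': "gcd (- p) (- q) = 1" using cop by simp
      have parity: "(- p) mod 2 = (- q) mod 2 \<longleftrightarrow> p mod 2 = q mod 2" by presburger
      show ?thesis
        using gap_near_rational[OF 2 cop' \<epsilon>]
        by (simp only: parity of_int_minus minus_divide_divide power2_minus minus_mult_minus
            mult_minus_right mult_minus_left minus_minus mult.assoc)
    qed
  qed
next
  fix \<epsilon> :: real assume \<epsilon>: "\<epsilon> > 0"
  show "\<forall>\<^sub>F n :: nat in sequentially. \<forall>k :: nat.
      1 \<le> k \<and> k < n \<and> real k \<le> (real n / 2) powr (2/3) \<longrightarrow>
      (\<exists>\<delta> :: real. \<bar>\<delta>\<bar> < \<epsilon> \<and>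
        gap n k = (1 + \<delta>) * (2 * pi\<^sup>2 * (real k + (real k)\<^sup>2) / (real n) ^ 3))"
    using \<epsilon> by (rule gap_small_k)
qed

end
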